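(* Let $K_{n_1,n_2,\ldots,n_t}$ denote the complete multipartite graph on $\sum_{s=1}^t n_s$ vertices. For all positive integers $r$, $\mathrm{reg}(R_{K_{n_1,n_2,\ldots,n_t}}/I_r(K_{n_1,n_2,\ldots,n_t}))=r$.
   Context: $\mathbb K$ is a field. For a finite simple graph $G$ with vertex set $V(G)$, $R_G$ is the polynomial ring over $\mathbb K$ whose variables are the vertices of $G$ (standard grading). For a positive integer $r$, $I_r(G)\subseteq R_G$ is the square-free monomial ideal generated by the monomials $\prod_{x\in A}x$, where $A$ ranges over all subsets $A\subseteq V(G)$ with $|A|=r+1$ such that the induced subgraph $G[A]$ is connected. In the complete multipartite graph $K_{n_1,\ldots,n_t}$ the vertices are divided into $t$ parts of sizes $n_1,\ldots,n_t$, and two vertices are adjacent if and only if they lie in different parts. $\beta_{i,j}(R/I)$ denotes the $(i,j)$-th graded Betti number of $R/I$, i.e. the multiplicity of $R(-j)$ in homological degree $i$ of its graded minimal free resolution, and the Castelnuovo-Mumford regularity is $\mathrm{reg}(R/I)=\max\{j-i\mid \beta_{i,j}(R/I)\ne 0\}$.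
   Formalization: The formal statement assumes at least two parts (t ≥ 2) and r < n_1+...+n_t; otherwise there is no connected induced subgraph on r+1 vertices, I_r = 0 and the regularity is 0, not r. *)

theory Defs
  imports
    "HOL-Library.Poly_Mapping"
    "HOL-Algebra.QuotRing"
    "HOL-Algebra.Module"
    "Graph_Theory.Graph_Theory"
begin

section \<open>The graph and its vertices\<close>

text \<open>
  A finite simple graph is a \<^locale>\<open>pair_graph\<close>: a finite, loop-free digraph whose arcs
  are ordered pairs and form a symmetric relation.  The vertex \<open>(s, j)\<close> of the complete
  multipartite graph is the \<open>j\<close>-th vertex of the \<open>s\<close>-th part, both counted from 0.
\<close>

definition complete_multipartite :: "nat list \<Rightarrow> (nat \<times> nat) pair_pre_digraph" where
  "complete_multipartite ns =
     (let V = {(s, j). s < length ns \<and> j < ns ! s}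
      in \<lparr> pverts = V, parcs = {(u, v). u \<in> V \<and> v \<in> V \<and> fst u \<noteq> fst v} \<rparr>)"


section \<open>Polynomial rings and the ideals \<open>I\<^sub>r(G)\<close>\<close>

text \<open>
  A monomial is a finitely supported exponent vector \<open>'v \<Rightarrow>\<^sub>0 nat\<close>, a polynomial a finitely
  supported family of coefficients indexed by monomials.
\<close>

type_synonym ('v, 'k) mpoly = "('v \<Rightarrow>\<^sub>0 nat) \<Rightarrow>\<^sub>0 'k"

definition var :: "'v \<Rightarrow> ('v, 'k::field) mpoly" where
  "var x = Poly_Mapping.single (Poly_Mapping.single x 1) 1"

definition poly_ring :: "'v set \<Rightarrow> ('v, 'k::field) mpoly ring" where
  "poly_ring V =
     \<lparr> carrier = {p. \<forall>m \<in> Poly_Mapping.keys p. Poly_Mapping.keys m \<subseteq> V},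
       monoid.mult = (*), one = 1, zero = 0, add = (+) \<rparr>"

definition mon_degree :: "('v \<Rightarrow>\<^sub>0 nat) \<Rightarrow> nat" where
  "mon_degree m = (\<Sum>x \<in> Poly_Mapping.keys m. Poly_Mapping.lookup m x)"

text \<open>Degrees are integers because of shifts; 0 is homogeneous of every degree.\<close>

definition homogeneous :: "int \<Rightarrow> ('v, 'k::field) mpoly \<Rightarrow> bool" where
  "homogeneous e p \<longleftrightarrow> (\<forall>m \<in> Poly_Mapping.keys p. int (mon_degree m) = e)"

definition irrelevant_ideal :: "'v set \<Rightarrow> ('v, 'k::field) mpoly set" where
  "irrelevant_ideal V = Idl\<^bsub>poly_ring V\<^esub> (var ` V)"

definition connected_ideal :: "nat \<Rightarrow> 'v pair_pre_digraph \<Rightarrow> ('v, 'k::field) mpoly set" where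
  "connected_ideal r G =
     Idl\<^bsub>poly_ring (pverts G)\<^esub>
       {\<Prod>x\<in>A. var x | A.
          A \<subseteq> pverts G \<and> card A = r + 1 \<and> Digraph_Component.connected (with_proj G \<restriction> A)}"


section \<open>Graded free modules and the graded module \<open>R/I\<close>\<close>

text \<open>
  Only the additive structure and the scalar multiplication of a module record are meaningful;
  the fields \<^const>\<open>monoid.mult\<close> and \<^const>\<open>one\<close> inherited from \<^typ>\<open>'a ring\<close> are left undefined.
  A vector of length \<open>n\<close> is padded with zeros from position \<open>n\<close> on.
\<close>

definition free_module ::
    "'v set \<Rightarrow> nat \<Rightarrow> (('v, 'k::field) mpoly, nat \<Rightarrow> ('v, 'k) mpoly) module" where
  "free_module V n =
     \<lparr> carrier = {v. (\<forall>k<n. v k \<in> carrier (poly_ring V)) \<and> (\<forall>k\<ge>n. v k = 0)},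
       monoid.mult = undefined, one = undefined,
       zero = (\<lambda>_. 0), add = (\<lambda>v w k. v k + w k), smult = (\<lambda>a v k. a * v k) \<rparr>"

definition quotient_module ::
    "'v set \<Rightarrow> ('v, 'k::field) mpoly set \<Rightarrow> (('v, 'k) mpoly, ('v, 'k) mpoly set) module" where
  "quotient_module V I = (let R = poly_ring V; Q = R Quot I in
     \<lparr> carrier = carrier Q, monoid.mult = undefined, one = undefined,
       zero = \<zero>\<^bsub>Q\<^esub>, add = (\<oplus>\<^bsub>Q\<^esub>),
       smult = (\<lambda>a X. (I +>\<^bsub>R\<^esub> a) \<otimes>\<^bsub>Q\<^esub> X) \<rparr>)"

definition linear_maps ::
    "('a, 'r) ring_scheme \<Rightarrow> ('a, 'b, 'm) module_scheme \<Rightarrow> ('a, 'c, 'n) module_scheme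
      \<Rightarrow> ('b \<Rightarrow> 'c) set" where
  "linear_maps R M N =
     {f. f \<in> carrier M \<rightarrow> carrier N
       \<and> (\<forall>x \<in> carrier M. \<forall>y \<in> carrier M. f (x \<oplus>\<^bsub>M\<^esub> y) = f x \<oplus>\<^bsub>N\<^esub> f y)
       \<and> (\<forall>a \<in> carrier R. \<forall>x \<in> carrier M. f (a \<odot>\<^bsub>M\<^esub> x) = a \<odot>\<^bsub>N\<^esub> f x)}"

text \<open>
  The degree \<open>e\<close> component of \<open>\<Oplus>\<^sub>k R(-d k)\<close>, where \<open>k < n\<close>: the \<open>k\<close>-th basis vector has
  degree \<open>d k\<close>.
\<close>

definition free_component ::
    "'v set \<Rightarrow> nat \<Rightarrow> (nat \<Rightarrow> int) \<Rightarrow> int \<Rightarrow> (nat \<Rightarrow> ('v, 'k::field) mpoly) set" where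
  "free_component V n d e =
     {v \<in> carrier (free_module V n). \<forall>k<n. homogeneous (e - d k) (v k)}"

definition quotient_component ::
    "'v set \<Rightarrow> ('v, 'k::field) mpoly set \<Rightarrow> int \<Rightarrow> ('v, 'k) mpoly set set" where
  "quotient_component V I e =
     {I +>\<^bsub>poly_ring V\<^esub> p | p. p \<in> carrier (poly_ring V) \<and> homogeneous e p}"


section \<open>Minimal graded free resolutions, Betti numbers, regularity\<close>

text \<open>
  The data of a graded complex \<open>\<dots> \<rightarrow> F\<^sub>2 \<rightarrow> F\<^sub>1 \<rightarrow> F\<^sub>0 \<rightarrow> R/I\<close> with
  \<open>F\<^sub>i = \<Oplus>\<^sub>k R(-shift i k)\<close>, where \<open>k < frank i\<close>.  The map \<open>bdry i\<close> goes from
  \<open>F\<^bsub>i+1\<^esub>\<close> to \<open>F\<^sub>i\<close>, and \<open>augm\<close> from \<open>F\<^sub>0\<close> to \<open>R/I\<close>.  All ranks are finite,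
  which is no restriction for a minimal resolution over a Noetherian ring.
\<close>

record (overloaded) ('v, 'k) graded_complex =
  frank :: "nat \<Rightarrow> nat"
  shift :: "nat \<Rightarrow> nat \<Rightarrow> int"
  bdry :: "nat \<Rightarrow> (nat \<Rightarrow> (('v \<Rightarrow>\<^sub>0 nat) \<Rightarrow>\<^sub>0 'k::zero)) \<Rightarrow> (nat \<Rightarrow> (('v \<Rightarrow>\<^sub>0 nat) \<Rightarrow>\<^sub>0 'k))"
  augm :: "(nat \<Rightarrow> (('v \<Rightarrow>\<^sub>0 nat) \<Rightarrow>\<^sub>0 'k)) \<Rightarrow> (('v \<Rightarrow>\<^sub>0 nat) \<Rightarrow>\<^sub>0 'k) set"

definition is_graded_free_resolution ::
    "'v set \<Rightarrow> ('v, 'k::field) mpoly set \<Rightarrow> ('v, 'k) graded_complex \<Rightarrow> bool" where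
  "is_graded_free_resolution V I C \<longleftrightarrow>
     (let R = poly_ring V;
          F = (\<lambda>i. free_module V (frank C i));
          Q = quotient_module V I;
          Fdeg = (\<lambda>i. free_component V (frank C i) (shift C i))
      in augm C \<in> linear_maps R (F 0) Q
       \<and> (\<forall>i. bdry C i \<in> linear_maps R (F (Suc i)) (F i))
       \<and> (\<forall>e. augm C ` Fdeg 0 e \<subseteq> quotient_component V I e)
       \<and> (\<forall>i e. bdry C i ` Fdeg (Suc i) e \<subseteq> Fdeg i e)
       \<and> augm C ` carrier (F 0) = carrier Q
       \<and> a_kernel (F 0) Q (augm C) = bdry C 0 ` carrier (F 1)
       \<and> (\<forall>i. a_kernel (F (Suc i)) (F i) (bdry C i)
               = bdry C (Suc i) ` carrier (F (Suc (Suc i)))))"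

text \<open>Minimality: \<open>bdry i\<close> maps into \<open>\<mm> F\<^sub>i\<close>, the vectors with all entries in \<open>\<mm>\<close>.\<close>

definition is_minimal_resolution ::
    "'v set \<Rightarrow> ('v, 'k::field) mpoly set \<Rightarrow> ('v, 'k) graded_complex \<Rightarrow> bool" where
  "is_minimal_resolution V I C \<longleftrightarrow>
     is_graded_free_resolution V I C
     \<and> (\<forall>i. \<forall>v \<in> carrier (free_module V (frank C (Suc i))).
            \<forall>k < frank C i. bdry C i v k \<in> irrelevant_ideal V)"

text \<open>
  The choice in the next definition is immaterial for \<open>V\<close> finite and \<open>I\<close> homogeneous: a minimal
  graded free resolution exists and is unique up to isomorphism.
\<close>

definition minimal_resolution ::
    "'v set \<Rightarrow> ('v, 'k::field) mpoly set \<Rightarrow> ('v, 'k) graded_complex" where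
  "minimal_resolution V I = (SOME C. is_minimal_resolution V I C)"

definition betti :: "'v set \<Rightarrow> ('v, 'k::field) mpoly set \<Rightarrow> nat \<Rightarrow> int \<Rightarrow> nat" where
  "betti V I i j =
     (let C = minimal_resolution V I in card {k. k < frank C i \<and> shift C i k = j})"

text \<open>The Castelnuovo-Mumford regularity of \<open>R/I\<close>.\<close>

definition regularity :: "'v set \<Rightarrow> ('v, 'k::field) mpoly set \<Rightarrow> int" where
  "regularity V I = Max {j - int i | i j. betti V I i j \<noteq> 0}"


section \<open>Basic facts\<close>

lemma complete_multipartite_pair_graph: "pair_graph (complete_multipartite ns)"
proof -
  have "finite (SIGMA s:{..<length ns}. {..<ns ! s})" by auto
  moreover have "{(s, j). s < length ns \<and> j < ns ! s} = (SIGMA s:{..<length ns}. {..<ns ! s})"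
    by auto
  ultimately have fin: "finite {(s, j). s < length ns \<and> j < ns ! s}" by simp
  have "finite {(u, v). u \<in> pverts (complete_multipartite ns)
                      \<and> v \<in> pverts (complete_multipartite ns) \<and> fst u \<noteq> fst v}"
    by (rule finite_subset[of _ "pverts (complete_multipartite ns) \<times> pverts (complete_multipartite ns)"])
       (use fin in \<open>auto simp: complete_multipartite_def Let_def\<close>)
  with fin show ?thesis
    by unfold_locales
       (auto simp: complete_multipartite_def Let_def symmetric_def intro!: symI)
qed

lemma card_complete_multipartite: "card (pverts (complete_multipartite ns)) = sum_list ns"
proof -
  have "pverts (complete_multipartite ns) = (SIGMA s:{..<length ns}. {..<ns ! s})"
    by (auto simp: complete_multipartite_def Let_def)
  then show ?thesis
    by (simp add: sum_list_sum_nth atLeast0LessThan)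
qed

lemma poly_ring_simps:
  "monoid.mult (poly_ring V) = (*)" "one (poly_ring V) = 1" "zero (poly_ring V) = 0" "add (poly_ring V) = (+)"
  by (simp_all add: poly_ring_def)

lemma poly_ring_closed:
  fixes p q :: "('v, 'k::field) mpoly"
  shows "0 \<in> carrier (poly_ring V :: ('v, 'k) mpoly ring)"
    and "1 \<in> carrier (poly_ring V :: ('v, 'k) mpoly ring)"
    and "p \<in> carrier (poly_ring V) \<Longrightarrow> - p \<in> carrier (poly_ring V)"
    and "\<lbrakk>p \<in> carrier (poly_ring V); q \<in> carrier (poly_ring V)\<rbrakk> \<Longrightarrow> p + q \<in> carrier (poly_ring V)"
    and "\<lbrakk>p \<in> carrier (poly_ring V); q \<in> carrier (poly_ring V)\<rbrakk> \<Longrightarrow> p * q \<in> carrier (poly_ring V)"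
proof -
  show "0 \<in> carrier (poly_ring V :: ('v, 'k) mpoly ring)"
    and "1 \<in> carrier (poly_ring V :: ('v, 'k) mpoly ring)"
    and "p \<in> carrier (poly_ring V) \<Longrightarrow> - p \<in> carrier (poly_ring V)"
    by (simp_all add: poly_ring_def)
  show "p + q \<in> carrier (poly_ring V)"
    if "p \<in> carrier (poly_ring V)" "q \<in> carrier (poly_ring V)"
    using that Poly_Mapping.keys_add[of p q] unfolding poly_ring_def by auto
  show "p * q \<in> carrier (poly_ring V)"
    if "p \<in> carrier (poly_ring V)" "q \<in> carrier (poly_ring V)"
  proof -
    have "Poly_Mapping.keys m \<subseteq> V" if m: "m \<in> Poly_Mapping.keys (p * q)" for m
    proof -
      from m obtain a b
        where "m = a + b" "a \<in> Poly_Mapping.keys p" "b \<in> Poly_Mapping.keys q"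
        using Poly_Mapping.keys_mult[of p q] by blast
      moreover have "Poly_Mapping.keys a \<subseteq> V" "Poly_Mapping.keys b \<subseteq> V"
        using calculation \<open>p \<in> _\<close> \<open>q \<in> _\<close> by (auto simp: poly_ring_def)
      ultimately show ?thesis
        using Poly_Mapping.keys_add[of a b] by blast
    qed
    then show ?thesis by (simp add: poly_ring_def)
  qed
qed

lemma cring_poly_ring: "cring (poly_ring V :: ('v, 'k::field) mpoly ring)"
proof (rule cringI)
  show "abelian_group (poly_ring V :: ('v, 'k) mpoly ring)"
  proof (rule abelian_groupI)
    fix p :: "('v, 'k) mpoly" assume "p \<in> carrier (poly_ring V)"
    then show "\<exists>q\<in>carrier (poly_ring V). q \<oplus>\<^bsub>poly_ring V\<^esub> p = \<zero>\<^bsub>poly_ring V\<^esub>"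
      by (intro bexI[of _ "- p"]) (simp_all add: poly_ring_simps poly_ring_closed)
  qed (simp_all add: poly_ring_simps poly_ring_closed add_ac)
  show "comm_monoid (poly_ring V :: ('v, 'k) mpoly ring)"
    by (rule comm_monoidI) (simp_all add: poly_ring_simps poly_ring_closed mult_ac)
qed (simp_all add: poly_ring_simps distrib_right)

lemma module_free_module:
  "Module.module (poly_ring V) (free_module V n :: (_, nat \<Rightarrow> ('v, 'k::field) mpoly) module)"
proof (rule moduleI)
  show "abelian_group (free_module V n :: (_, nat \<Rightarrow> ('v, 'k) mpoly) module)"
  proof (rule abelian_groupI)
    fix v :: "nat \<Rightarrow> ('v, 'k) mpoly" assume "v \<in> carrier (free_module V n)"
    then show "\<exists>w\<in>carrier (free_module V n). w \<oplus>\<^bsub>free_module V n\<^esub> v = \<zero>\<^bsub>free_module V n\<^esub>"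
      by (intro bexI[of _ "\<lambda>k. - v k"]) (simp_all add: free_module_def poly_ring_closed)
  qed (simp_all add: free_module_def poly_ring_closed add_ac)
qed (simp_all add: cring_poly_ring free_module_def poly_ring_simps poly_ring_closed
       distrib_left distrib_right mult.assoc)

lemma module_quotient_module:
  fixes I :: "('v, 'k::field) mpoly set"
  assumes "ideal I (poly_ring V)"
  shows "Module.module (poly_ring V) (quotient_module V I)"
proof -
  interpret ideal I "poly_ring V :: ('v, 'k) mpoly ring" by (fact assms)
  interpret R: cring "poly_ring V :: ('v, 'k) mpoly ring" by (rule cring_poly_ring)
  interpret h: ring_hom_ring "poly_ring V" "poly_ring V Quot I" "(+>\<^bsub>poly_ring V\<^esub>) I"
    by (rule rcos_ring_hom_ring)
  define Q where "Q = poly_ring V Quot I"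
  have Q: "quotient_module V I =
      \<lparr> carrier = carrier Q, monoid.mult = undefined, one = undefined,
        zero = \<zero>\<^bsub>Q\<^esub>, add = (\<oplus>\<^bsub>Q\<^esub>),
        smult = (\<lambda>a X. (I +>\<^bsub>poly_ring V\<^esub> a) \<otimes>\<^bsub>Q\<^esub> X) \<rparr>"
    by (simp add: quotient_module_def Q_def Let_def)
  note hom = h.hom_closed h.hom_add h.hom_mult h.hom_one
  note hom = hom[folded Q_def]
  interpret Q: cring Q
    unfolding Q_def by (rule quotient_is_cring[OF R.is_cring])
  show ?thesis
  proof (rule moduleI)
    show "abelian_group (quotient_module V I)"
    proof (rule abelian_groupI)
      fix X assume "X \<in> carrier (quotient_module V I)"
      then show "\<exists>Y \<in> carrier (quotient_module V I).
          Y \<oplus>\<^bsub>quotient_module V I\<^esub> X = \<zero>\<^bsub>quotient_module V I\<^esub>"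
        by (intro bexI[of _ "\<ominus>\<^bsub>Q\<^esub> X"]) (simp_all add: Q Q.l_neg)
    qed (simp_all add: Q Q.a_ac)
  qed (simp_all add: Q hom R.cring_axioms Q_def[symmetric] Q.l_distr Q.r_distr Q.m_assoc)
qed

end

theory Submission
  imports Defs "HOL-Library.Function_Algebras"
begin

text \<open>
  A set of at least two vertices of a complete multipartite graph induces a connected subgraph iff
  it meets two parts, and the \<open>(r + 1)\<close>-sets meeting two parts satisfy the basis exchange property.
  Adding such bases to the ideal one at a time, in a suitable order, each colon ideal is generated by
  variables (linear quotients), so iterated mapping cones give a graded free resolution with
  \<open>F\<^sub>0 = R\<close> and \<open>F\<^sub>i\<close> generated in degree \<open>i + r\<close> for \<open>i > 0\<close>; the colon ideals are resolved by
  the same cones.  For degree reasons this resolution is minimal.  Since chain maps between two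
  minimal resolutions are inverse to each other up to homotopy, hence modulo the irrelevant ideal,
  every minimal resolution has the same shifts, and the regularity is \<open>r\<close>.
\<close>

section \<open>Homogeneous parts\<close>

text \<open>The regularity is read off a resolution picked by \<open>SOME\<close>, so exhibiting one
  resolution does not settle it: its existence makes the picked one minimal, and a comparison then
  transports the degrees. The maximum only asks which Betti numbers are nonzero, so it is enough
  that two minimal resolutions use the same set of degrees at each step. Linearity survives every
  addition of a generator for a numerical reason. If I is generated in degree c and J is the colon
  ideal by the new generator, then F_i of the cone is F_i(I) plus F_{i-1}(J)(-c). The first summand
  sits in degree i - 1 + c; the second, J being generated by variables, in degree (i - 1) + c.
  Generators of the ideal of the graph have r + 1 vertices, so c = r + 1, and j - i = r for all i >
  0.\<close>

definition hpart :: "int \<Rightarrow> ('v, 'k::field) mpoly \<Rightarrow> ('v, 'k) mpoly" where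
  "hpart e p = (\<Sum>m | m \<in> Poly_Mapping.keys p \<and> int (mon_degree m) = e.
      Poly_Mapping.single m (Poly_Mapping.lookup p m))"

lemma lookup_hpart:
  "Poly_Mapping.lookup (hpart e p) m = (if int (mon_degree m) = e then Poly_Mapping.lookup p m else 0)"
proof -
  have "Poly_Mapping.lookup (hpart e p) m =
      (\<Sum>k | k \<in> Poly_Mapping.keys p \<and> int (mon_degree k) = e. Poly_Mapping.lookup p k when k = m)"
    by (simp add: hpart_def lookup_sum lookup_single)
  also have "\<dots> = (\<Sum>k | k \<in> Poly_Mapping.keys p \<and> int (mon_degree k) = e.
      if m = k then Poly_Mapping.lookup p k else 0)"
    by (intro sum.cong) (auto simp: when_def)
  also have "\<dots> = (if int (mon_degree m) = e then Poly_Mapping.lookup p m else 0)"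
    by (subst sum.delta') (auto simp: in_keys_iff)
  finally show ?thesis .
qed

lemma keys_hpart: "Poly_Mapping.keys (hpart e p) = {m \<in> Poly_Mapping.keys p. int (mon_degree m) = e}"
  by (auto simp: in_keys_iff lookup_hpart split: if_splits)

lemma homogeneous_hpart [simp]: "homogeneous e (hpart e p)"
  by (simp add: homogeneous_def keys_hpart)

lemma hpart_closed: "p \<in> carrier (poly_ring V) \<Longrightarrow> hpart e p \<in> carrier (poly_ring V)"
  by (auto simp: poly_ring_def keys_hpart)

lemma hpart_0 [simp]: "hpart e 0 = 0"
  by (rule poly_mapping_eqI) (simp add: lookup_hpart)

lemma hpart_add: "hpart e (p + q) = hpart e p + hpart e q"
  by (rule poly_mapping_eqI) (simp add: lookup_hpart lookup_add)

lemma hpart_minus: "hpart e (p - q) = hpart e p - hpart e q"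
  by (rule poly_mapping_eqI) (simp add: lookup_hpart lookup_minus)

lemma hpart_sum: "hpart e (sum f A) = (\<Sum>x\<in>A. hpart e (f x))"
  by (induction A rule: infinite_finite_induct) (simp_all add: hpart_add)

lemma hpart_homogeneous: "homogeneous e p \<Longrightarrow> hpart e' p = (if e = e' then p else 0)"
  by (rule poly_mapping_eqI) (auto simp: lookup_hpart homogeneous_def in_keys_iff)

lemma sum_hpart:
  assumes "finite E" "(\<lambda>m. int (mon_degree m)) ` Poly_Mapping.keys p \<subseteq> E"
  shows "(\<Sum>e\<in>E. hpart e p) = p"
proof (rule poly_mapping_eqI)
  fix m
  have "Poly_Mapping.lookup (\<Sum>e\<in>E. hpart e p) m =
      (\<Sum>e\<in>E. if int (mon_degree m) = e then Poly_Mapping.lookup p m else 0)"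
    by (simp add: lookup_sum lookup_hpart)
  also have "\<dots> = (if int (mon_degree m) \<in> E then Poly_Mapping.lookup p m else 0)"
    using assms(1) by (subst sum.delta') auto
  also have "\<dots> = Poly_Mapping.lookup p m"
  proof -
    have "m \<in> Poly_Mapping.keys p \<Longrightarrow> int (mon_degree m) \<in> E"
      using assms(2) by blast
    then show ?thesis
      using not_in_keys_iff_lookup_eq_zero[of m p] by presburger
  qed
  finally show "Poly_Mapping.lookup (\<Sum>e\<in>E. hpart e p) m = Poly_Mapping.lookup p m" .
qed

section \<open>Degrees of monomials and homogeneous polynomials\<close>

lemma mon_degree_0 [simp]: "mon_degree 0 = 0"
  by (simp add: mon_degree_def)

lemma mon_degree_eq_sum:
  assumes "finite S" "Poly_Mapping.keys m \<subseteq> S"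
  shows "mon_degree m = (\<Sum>x\<in>S. Poly_Mapping.lookup m x)"
  unfolding mon_degree_def using assms
  by (intro sum.mono_neutral_left) (auto simp: in_keys_iff)

lemma mon_degree_add: "mon_degree (a + b) = mon_degree a + mon_degree b"
proof -
  define S where "S = Poly_Mapping.keys a \<union> Poly_Mapping.keys b"
  have S: "finite S" "Poly_Mapping.keys (a + b) \<subseteq> S" "Poly_Mapping.keys a \<subseteq> S" "Poly_Mapping.keys b \<subseteq> S"
    using Poly_Mapping.keys_add[of a b] by (auto simp: S_def)
  show ?thesis
    using S(1) by (simp add: mon_degree_eq_sum[OF S(1,2)] mon_degree_eq_sum[OF S(1,3)]
        mon_degree_eq_sum[OF S(1,4)] lookup_add sum.distrib)
qed

lemma homogeneous_0 [simp]: "homogeneous e 0"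
  by (simp add: homogeneous_def)

lemma homogeneous_1: "homogeneous 0 1"
  by (simp add: homogeneous_def)

lemma homogeneous_add: "homogeneous e p \<Longrightarrow> homogeneous e q \<Longrightarrow> homogeneous e (p + q)"
  using Poly_Mapping.keys_add[of p q] by (auto simp: homogeneous_def)

lemma homogeneous_uminus: "homogeneous e p \<Longrightarrow> homogeneous e (- p)"
  by (simp add: homogeneous_def)

lemma homogeneous_diff: "homogeneous e p \<Longrightarrow> homogeneous e q \<Longrightarrow> homogeneous e (p - q)"
  using homogeneous_add[of e p "- q"] by (simp add: homogeneous_uminus)

lemma homogeneous_mult:
  assumes "homogeneous a p" "homogeneous b q"
  shows "homogeneous (a + b) (p * q)"
  unfolding homogeneous_def
proof
  fix m assume "m \<in> Poly_Mapping.keys (p * q)"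
  then obtain u w where "m = u + w" "u \<in> Poly_Mapping.keys p" "w \<in> Poly_Mapping.keys q"
    using Poly_Mapping.keys_mult[of p q] by blast
  then show "int (mon_degree m) = a + b"
    using assms by (simp add: homogeneous_def mon_degree_add)
qed

lemma poly_ring_sum_closed:
  "(\<And>x. x \<in> A \<Longrightarrow> f x \<in> carrier (poly_ring V)) \<Longrightarrow> sum f A \<in> carrier (poly_ring V)"
  by (induction A rule: infinite_finite_induct) (auto simp: poly_ring_closed)

lemma poly_ring_diff_closed:
  "p \<in> carrier (poly_ring V) \<Longrightarrow> q \<in> carrier (poly_ring V) \<Longrightarrow> p - q \<in> carrier (poly_ring V)"
  using poly_ring_closed(4)[of p V "- q"] by (simp add: poly_ring_closed)

lemmas ring_closed = poly_ring_closed poly_ring_diff_closed poly_ring_sum_closed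


section \<open>Graded linear maps between graded free modules\<close>

type_synonym ('v, 'k) pvec = "nat \<Rightarrow> ('v, 'k) mpoly"

definition smul :: "('v, 'k::field) mpoly \<Rightarrow> ('v, 'k) pvec \<Rightarrow> ('v, 'k) pvec" where
  "smul a v = (\<lambda>k. a * v k)"

lemma smul_apply [simp]: "smul a v k = a * v k"
  by (simp add: smul_def)

text \<open>Ring membership is stated at every index, including those padded with zeros, so that
  closure proofs go pointwise without splitting on \<open>k < n\<close>; \<open>gcomp\<close> does
  the same for homogeneity.\<close>

definition fmod :: "'v set \<Rightarrow> nat \<Rightarrow> ('v, 'k::field) pvec set" where
  "fmod V n = {v. (\<forall>k. v k \<in> carrier (poly_ring V)) \<and> (\<forall>k\<ge>n. v k = 0)}"

definition gcomp :: "'v set \<Rightarrow> nat \<Rightarrow> (nat \<Rightarrow> int) \<Rightarrow> int \<Rightarrow> ('v, 'k::field) pvec set" where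
  "gcomp V n d e = {v \<in> fmod V n. \<forall>k. homogeneous (e - d k) (v k)}"

lemma carrier_free_module: "carrier (free_module V n) = fmod V n"
proof -
  have "v k \<in> carrier (poly_ring V)"
    if "\<forall>k<n. v k \<in> carrier (poly_ring V)" "\<forall>k\<ge>n. v k = 0" for v :: "('a,'b) pvec" and k
    using that by (cases "k < n") (auto simp: poly_ring_closed)
  then show ?thesis
    by (auto simp: free_module_def fmod_def)
qed

lemma free_component_eq: "free_component V n d e = gcomp V n d e"
proof -
  have "homogeneous (e - d k) (v k)"
    if "\<forall>k<n. homogeneous (e - d k) (v k)" "v \<in> fmod V n" for v :: "('a,'b) pvec" and k
    using that by (cases "k < n") (auto simp: fmod_def)
  then show ?thesis
    unfolding free_component_def carrier_free_module gcomp_def by auto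
qed

lemma fmod_closed:
  "0 \<in> fmod V n" "v \<in> fmod V n \<Longrightarrow> w \<in> fmod V n \<Longrightarrow> v + w \<in> fmod V n"
  "v \<in> fmod V n \<Longrightarrow> w \<in> fmod V n \<Longrightarrow> v - w \<in> fmod V n"
  "v \<in> fmod V n \<Longrightarrow> - v \<in> fmod V n"
  "a \<in> carrier (poly_ring V) \<Longrightarrow> v \<in> fmod V n \<Longrightarrow> smul a v \<in> fmod V n"
  by (auto simp: fmod_def ring_closed)

lemma fmod_sum_closed:
  "(\<And>x. x \<in> A \<Longrightarrow> f x \<in> fmod V n) \<Longrightarrow> sum f A \<in> fmod V n"
  by (induction A rule: infinite_finite_induct) (auto simp: fmod_closed)

lemma gcomp_fmod: "v \<in> gcomp V n d e \<Longrightarrow> v \<in> fmod V n"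
  by (simp add: gcomp_def)

lemma gcomp_closed:
  "0 \<in> gcomp V n d e" "v \<in> gcomp V n d e \<Longrightarrow> w \<in> gcomp V n d e \<Longrightarrow> v + w \<in> gcomp V n d e"
  "v \<in> gcomp V n d e \<Longrightarrow> w \<in> gcomp V n d e \<Longrightarrow> v - w \<in> gcomp V n d e"
  "v \<in> gcomp V n d e \<Longrightarrow> - v \<in> gcomp V n d e"
  by (auto simp: gcomp_def fmod_closed homogeneous_add homogeneous_diff homogeneous_uminus)

lemma smul_gcomp:
  assumes "a \<in> carrier (poly_ring V)" "homogeneous c a" "v \<in> gcomp V n d e"
  shows "smul a v \<in> gcomp V n d (c + e)"
  using assms homogeneous_mult[of c a "e - d _" "v _"]
  by (auto simp: gcomp_def fmod_closed add_diff_eq)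

lemma sum_apply: "(sum f A :: 'a \<Rightarrow> 'b::comm_monoid_add) k = (\<Sum>x\<in>A. f x k)"
  by (induction A rule: infinite_finite_induct) auto

definition unitv :: "nat \<Rightarrow> ('v, 'k::field) pvec" where
  "unitv k = (\<lambda>j. if j = k then 1 else 0)"

lemma unitv_gcomp: "k < n \<Longrightarrow> unitv k \<in> gcomp V n d (d k)"
  by (auto simp: gcomp_def fmod_def unitv_def ring_closed homogeneous_1)

lemma unitv_fmod: "k < n \<Longrightarrow> unitv k \<in> fmod V n"
  by (rule gcomp_fmod[OF unitv_gcomp])

lemma fmod_expand:
  assumes "v \<in> fmod V n"
  shows "v = (\<Sum>k<n. smul (v k) (unitv k))"
proof
  fix j
  have "(\<Sum>k<n. smul (v k) (unitv k)) j = (\<Sum>k<n. if j = k then v j else 0)"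
    unfolding sum_apply by (intro sum.cong) (auto simp: unitv_def)
  also have "\<dots> = v j"
    using assms by (subst sum.delta') (auto simp: fmod_def)
  finally show "v j = (\<Sum>k<n. smul (v k) (unitv k)) j" by simp
qed

text \<open>A linear map of degree 0 from the sum of the R(-d k) with k < n to the sum of the R(-d'
  k) with k < m. All conditions are relative to \<open>fmod V n\<close>; values elsewhere are
  arbitrary.\<close>

definition ghom :: "'v set \<Rightarrow> nat \<Rightarrow> (nat \<Rightarrow> int) \<Rightarrow> nat \<Rightarrow> (nat \<Rightarrow> int)
    \<Rightarrow> (('v, 'k::field) pvec \<Rightarrow> ('v, 'k) pvec) \<Rightarrow> bool" where
  "ghom V n d m d' f \<longleftrightarrow>
     (\<forall>v \<in> fmod V n. f v \<in> fmod V m)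
   \<and> (\<forall>v \<in> fmod V n. \<forall>w \<in> fmod V n. f (v + w) = f v + f w)
   \<and> (\<forall>a \<in> carrier (poly_ring V). \<forall>v \<in> fmod V n. f (smul a v) = smul a (f v))
   \<and> (\<forall>e. \<forall>v \<in> gcomp V n d e. f v \<in> gcomp V m d' e)"

lemma ghomD:
  assumes "ghom V n d m d' f"
  shows "v \<in> fmod V n \<Longrightarrow> f v \<in> fmod V m"
    and "v \<in> fmod V n \<Longrightarrow> w \<in> fmod V n \<Longrightarrow> f (v + w) = f v + f w"
    and "a \<in> carrier (poly_ring V) \<Longrightarrow> v \<in> fmod V n \<Longrightarrow> f (smul a v) = smul a (f v)"
    and "v \<in> gcomp V n d e \<Longrightarrow> f v \<in> gcomp V m d' e"
  using assms by (auto simp: ghom_def)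

lemma ghom_0: "ghom V n d m d' f \<Longrightarrow> f 0 = 0"
  using ghomD(2)[of V n d m d' f 0 0] by (simp add: fmod_closed)

lemma ghom_uminus: "ghom V n d m d' f \<Longrightarrow> v \<in> fmod V n \<Longrightarrow> f (- v) = - f v"
  using ghomD(2)[of V n d m d' f v "- v"] ghom_0[of V n d m d' f]
  by (simp add: fmod_closed) (metis neg_eq_iff_add_eq_0)

lemma ghom_diff:
  "ghom V n d m d' f \<Longrightarrow> v \<in> fmod V n \<Longrightarrow> w \<in> fmod V n \<Longrightarrow> f (v - w) = f v - f w"
  using ghomD(2)[of V n d m d' f v "- w"] ghom_uminus[of V n d m d' f w]
  by (simp add: fmod_closed)

lemma ghom_sum:
  assumes "ghom V n d m d' f" "\<And>x. x \<in> A \<Longrightarrow> g x \<in> fmod V n"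
  shows "f (sum g A) = (\<Sum>x\<in>A. f (g x))"
  using assms(2)
  by (induction A rule: infinite_finite_induct)
    (auto simp: ghom_0[OF assms(1)] ghomD(2)[OF assms(1)] fmod_sum_closed)

lemma ghom_expand:
  assumes "ghom V n d m d' f" "v \<in> fmod V n"
  shows "f v = (\<Sum>k<n. smul (v k) (f (unitv k)))"
proof -
  have v: "v k \<in> carrier (poly_ring V)" for k
    using assms(2) by (simp add: fmod_def)
  have "f v = f (\<Sum>k<n. smul (v k) (unitv k))"
    using fmod_expand[OF assms(2)] by simp
  also have "\<dots> = (\<Sum>k<n. smul (v k) (f (unitv k)))"
    by (subst ghom_sum[OF assms(1)])
      (auto intro!: sum.cong ghomD(3)[OF assms(1)] fmod_closed v unitv_fmod)
  finally show ?thesis .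
qed

lemma ghom_compose:
  "ghom V n d m d' f \<Longrightarrow> ghom V m d' l d'' g \<Longrightarrow> ghom V n d l d'' (\<lambda>v. g (f v))"
  by (simp add: ghom_def)

lemma ghom_add:
  "ghom V n d m d' f \<Longrightarrow> ghom V n d m d' g \<Longrightarrow> ghom V n d m d' (\<lambda>v. f v + g v)"
  by (auto simp: ghom_def fmod_closed gcomp_closed fun_eq_iff algebra_simps)

lemma ghom_minus:
  "ghom V n d m d' f \<Longrightarrow> ghom V n d m d' g \<Longrightarrow> ghom V n d m d' (\<lambda>v. f v - g v)"
  by (auto simp: ghom_def fmod_closed gcomp_closed fun_eq_iff algebra_simps)

lemma ghom_zero: "ghom V n d m d' (\<lambda>_. 0)"
  by (auto simp: ghom_def fmod_closed gcomp_closed fun_eq_iff)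

lemma ghom_id: "ghom V n d n d (\<lambda>v. v)"
  by (auto simp: ghom_def)

lemma ghom_cong:
  "ghom V n d m d' f \<Longrightarrow> (\<And>v. v \<in> fmod V n \<Longrightarrow> g v = f v) \<Longrightarrow> ghom V n d m d' g"
  by (auto simp: ghom_def fmod_closed gcomp_fmod)

lemma ghom_shift:
  fixes f :: "('a, 'b::field) pvec \<Rightarrow> ('a, 'b) pvec"
  assumes "ghom V n d m d' f"
  shows "ghom V n (\<lambda>k. d k + c) m (\<lambda>k. d' k + c) f"
proof -
  have "gcomp V n (\<lambda>k. d k + c) e = (gcomp V n d (e - c) :: ('a, 'b) pvec set)"
    for n and d :: "nat \<Rightarrow> int" and e
    by (simp add: gcomp_def algebra_simps)
  then show ?thesis
    using assms by (simp add: ghom_def)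
qed

text \<open>Freeness in graded form: the images of the basis vectors can be prescribed, provided
  that each has the degree of its basis vector.\<close>

lemma ghom_of_basis:
  assumes "\<And>k. k < n \<Longrightarrow> w k \<in> gcomp V m d' (d k)"
  shows "ghom V n d m d' (\<lambda>v. \<Sum>k<n. smul (v k) (w k))"
proof -
  have "(\<Sum>k<n. smul (v k) (w k)) \<in> gcomp V m d' e" if "v \<in> gcomp V n d e" for v e
  proof -
    have "smul (v k) (w k) \<in> gcomp V m d' e" if "k < n" for k
      using smul_gcomp[OF _ _ assms[OF that], of "v k" "e - d k"] \<open>v \<in> _\<close>
      by (auto simp: gcomp_def fmod_def)
    then have "S \<subseteq> {..<n} \<Longrightarrow> (\<Sum>k\<in>S. smul (v k) (w k)) \<in> gcomp V m d' e" for S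
      by (induction S rule: infinite_finite_induct) (auto simp: gcomp_closed)
    then show ?thesis by simp
  qed
  moreover have "(\<Sum>k<n. smul (v k) (w k)) \<in> fmod V m" if "v \<in> fmod V n" for v
    using that assms by (auto simp: fmod_def gcomp_def sum_apply intro!: ring_closed sum.neutral)
  ultimately show ?thesis
    by (auto simp: ghom_def fun_eq_iff sum_apply sum.distrib[symmetric] sum_distrib_left
        algebra_simps)
qed

lemma basis_sum_unitv: "j < n \<Longrightarrow> (\<Sum>k<n. smul (unitv j k) (w k)) = w j"
proof -
  assume "j < n"
  have "(\<Sum>k<n. smul (unitv j k) (w k)) = (\<Sum>k<n. if j = k then w j else 0)"
    by (intro sum.cong) (auto simp: unitv_def fun_eq_iff)
  then show ?thesis using \<open>j < n\<close> by simp
qed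

section \<open>Homogeneous components of vectors, graded submodules and graded lifting\<close>

definition vpart :: "(nat \<Rightarrow> int) \<Rightarrow> int \<Rightarrow> ('v, 'k::field) pvec \<Rightarrow> ('v, 'k) pvec" where
  "vpart d e v = (\<lambda>k. hpart (e - d k) (v k))"

lemma vpart_gcomp: "v \<in> fmod V n \<Longrightarrow> vpart d e v \<in> gcomp V n d e"
  by (auto simp: vpart_def gcomp_def fmod_def hpart_closed)

lemma vpart_gcomp_eq:
  assumes "v \<in> gcomp V n d e"
  shows "vpart d e' v = (if e' = e then v else 0)"
proof -
  have "hpart (e' - d k) (v k) = (if e' = e then v k else 0)" for k
    using assms hpart_homogeneous[of "e - d k" "v k" "e' - d k"] by (auto simp: gcomp_def)
  then show ?thesis by (auto simp: vpart_def)
qed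

lemma vpart_diff: "vpart d e (v - w) = vpart d e v - vpart d e w"
  by (auto simp: vpart_def hpart_minus)

lemma vpart_sum: "vpart d e (sum f A) = (\<Sum>x\<in>A. vpart d e (f x))"
  by (auto simp: vpart_def hpart_sum sum_apply fun_eq_iff)

text \<open>Only finitely many degrees occur, since there are finitely many nonzero entries, each
  with finitely many monomials. A prescribed degree \<open>e0\<close> is put into \<open>E\<close>
  so that its component can be singled out of the sum.\<close>

lemma vpart_expand:
  assumes "v \<in> fmod V n"
  obtains E where "finite E" "v = (\<Sum>e\<in>E. vpart d e v)" "e0 \<in> E"
proof -
  define E where
    "E = insert e0 (\<Union>k<n. (\<lambda>e. e + d k) ` (\<lambda>m. int (mon_degree m)) ` Poly_Mapping.keys (v k))"
  have E: "finite E" "e0 \<in> E" by (auto simp: E_def)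
  have "v k = (\<Sum>e\<in>E. vpart d e v k)" for k
  proof (cases "k < n")
    case True
    have "(\<Sum>e\<in>E. vpart d e v k) = (\<Sum>e\<in>(\<lambda>e. e - d k) ` E. hpart e (v k))"
      by (subst sum.reindex) (auto simp: inj_on_def vpart_def)
    also have "\<dots> = v k"
    proof (rule sum_hpart)
      show "(\<lambda>m. int (mon_degree m)) ` Poly_Mapping.keys (v k) \<subseteq> (\<lambda>e. e - d k) ` E"
      proof
        fix x assume "x \<in> (\<lambda>m. int (mon_degree m)) ` Poly_Mapping.keys (v k)"
        then have "x + d k \<in> E" using True by (auto simp: E_def)
        then show "x \<in> (\<lambda>e. e - d k) ` E" by (rule rev_image_eqI) simp
      qed
    qed (use E in auto)
    finally show ?thesis ..
  next
    case False
    then show ?thesis using assms by (simp add: fmod_def vpart_def)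
  qed
  then have "v = (\<Sum>e\<in>E. vpart d e v)"
    by (simp add: fun_eq_iff sum_apply)
  with E that show thesis by blast
qed

lemma ghom_vpart:
  assumes f: "ghom V n d m d' f" and v: "v \<in> fmod V n"
  shows "vpart d' e (f v) = f (vpart d e v)"
proof -
  obtain E where E: "finite E" "v = (\<Sum>x\<in>E. vpart d x v)" "e \<in> E"
    using vpart_expand[OF v] by blast
  have "f v = (\<Sum>x\<in>E. f (vpart d x v))"
    by (subst E(2), subst ghom_sum[OF f]) (auto intro: gcomp_fmod vpart_gcomp v)
  then have "vpart d' e (f v) = (\<Sum>x\<in>E. vpart d' e (f (vpart d x v)))"
    by (simp add: vpart_sum)
  also have "\<dots> = (\<Sum>x\<in>E. if x = e then f (vpart d e v) else 0)"
    by (intro sum.cong) (auto simp: vpart_gcomp_eq[OF ghomD(4)[OF f vpart_gcomp[OF v]]])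
  also have "\<dots> = f (vpart d e v)"
    using E by simp
  finally show ?thesis .
qed

text \<open>It abstracts the two submodules modulo which equations of complexes will hold: the ideal
  inside R, and the zero module.\<close>

definition gsubmod :: "'v set \<Rightarrow> nat \<Rightarrow> (nat \<Rightarrow> int) \<Rightarrow> ('v, 'k::field) pvec set \<Rightarrow> bool" where
  "gsubmod V n d B \<longleftrightarrow> B \<subseteq> fmod V n \<and> 0 \<in> B \<and> (\<forall>v\<in>B. \<forall>w\<in>B. v + w \<in> B)
     \<and> (\<forall>a \<in> carrier (poly_ring V). \<forall>v\<in>B. smul a v \<in> B) \<and> (\<forall>e. \<forall>v\<in>B. vpart d e v \<in> B)"

lemma gsubmodD:
  assumes "gsubmod V n d B"
  shows "v \<in> B \<Longrightarrow> v \<in> fmod V n" "0 \<in> B" "v \<in> B \<Longrightarrow> w \<in> B \<Longrightarrow> v + w \<in> B"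
    "a \<in> carrier (poly_ring V) \<Longrightarrow> v \<in> B \<Longrightarrow> smul a v \<in> B" "v \<in> B \<Longrightarrow> vpart d e v \<in> B"
  using assms unfolding gsubmod_def by blast+

lemma gsubmod_uminus: "gsubmod V n d B \<Longrightarrow> v \<in> B \<Longrightarrow> - v \<in> B"
proof -
  assume "gsubmod V n d B" "v \<in> B"
  then have "smul (- 1) v \<in> B"
    by (intro gsubmodD(4) ring_closed)
  moreover have "smul (- 1) v = - v"
    by (simp add: fun_eq_iff)
  ultimately show ?thesis by simp
qed

lemma gsubmod_diff: "gsubmod V n d B \<Longrightarrow> v \<in> B \<Longrightarrow> w \<in> B \<Longrightarrow> v - w \<in> B"
  using gsubmodD(3)[of V n d B v "- w"] gsubmod_uminus[of V n d B w] by simp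

lemma gsubmod_sum:
  assumes "gsubmod V n d B"
  shows "(\<And>x. x \<in> A \<Longrightarrow> f x \<in> B) \<Longrightarrow> sum f A \<in> B"
  by (induction A rule: infinite_finite_induct) (auto simp: gsubmodD[OF assms])

text \<open>Projectivity of graded free modules relative to a graded submodule \<open>B\<close>:
  preimages modulo \<open>B\<close> are chosen on the basis and extended linearly.\<close>

lemma ghom_lift:
  assumes u: "ghom V n d l d'' u" and g: "ghom V m d' l d'' g" and B: "gsubmod V l d'' B"
    and ex: "\<And>v. v \<in> fmod V n \<Longrightarrow> \<exists>w \<in> fmod V m. u v - g w \<in> B"
  obtains f where "ghom V n d m d' f" "\<And>v. v \<in> fmod V n \<Longrightarrow> u v - g (f v) \<in> B"
proof -
  have "\<exists>w. w \<in> gcomp V m d' (d k) \<and> u (unitv k) - g w \<in> B" if k: "k < n" for k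
  proof -
    obtain w where w: "w \<in> fmod V m" "u (unitv k) - g w \<in> B"
      using ex[OF unitv_fmod[OF k]] by blast
    \<comment> \<open>The chosen \<open>w\<close> may be inhomogeneous. As
      \<open>u (unitv k)\<close> has degree \<open>d k\<close> and \<open>B\<close> is graded, the
      component of \<open>w\<close> in degree \<open>d k\<close> is a preimage as well.\<close>
    have "vpart d'' (d k) (u (unitv k) - g w) = u (unitv k) - g (vpart d' (d k) w)"
      by (simp add: vpart_diff ghom_vpart[OF g w(1)]
          vpart_gcomp_eq[OF ghomD(4)[OF u unitv_gcomp[OF k]]])
    then have "u (unitv k) - g (vpart d' (d k) w) \<in> B"
      using gsubmodD(5)[OF B w(2), of "d k"] by (simp only:)
    then show ?thesis
      using vpart_gcomp[OF w(1), of d' "d k"] by blast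
  qed
  then have "\<forall>k\<in>{..<n}. \<exists>w. w \<in> gcomp V m d' (d k) \<and> u (unitv k) - g w \<in> B"
    by blast
  then obtain w where "\<forall>k\<in>{..<n}. w k \<in> gcomp V m d' (d k) \<and> u (unitv k) - g (w k) \<in> B"
    by (rule bchoice[THEN exE])
  then have w: "\<And>k. k < n \<Longrightarrow> w k \<in> gcomp V m d' (d k)"
      "\<And>k. k < n \<Longrightarrow> u (unitv k) - g (w k) \<in> B"
    by blast+
  define f where "f = (\<lambda>v. \<Sum>k<n. smul (v k) (w k))"
  have f: "ghom V n d m d' f"
    unfolding f_def using w(1) by (rule ghom_of_basis)
  have gf: "ghom V n d l d'' (\<lambda>v. u v - g (f v))"
    by (rule ghom_minus[OF u ghom_compose[OF f g]])
  have "u v - g (f v) \<in> B" if "v \<in> fmod V n" for v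
  proof -
    have v: "v k \<in> carrier (poly_ring V)" for k
      using that by (simp add: fmod_def)
    have "u v - g (f v) = (\<Sum>k<n. smul (v k) (u (unitv k) - g (f (unitv k))))"
      by (rule ghom_expand[OF gf that])
    also have "\<dots> \<in> B"
    proof (rule gsubmod_sum[OF B], rule gsubmodD(4)[OF B v])
      fix k assume "k \<in> {..<n}"
      then show "u (unitv k) - g (f (unitv k)) \<in> B"
        using w(2)[of k] by (simp only: f_def basis_sum_unitv lessThan_iff)
    qed
    finally show ?thesis .
  qed
  with f that show thesis by blast
qed


section \<open>Complexes augmented to the polynomial ring\<close>

definition hideal :: "'v set \<Rightarrow> ('v, 'k::field) mpoly set \<Rightarrow> bool" where
  "hideal V I \<longleftrightarrow> I \<subseteq> carrier (poly_ring V) \<and> 0 \<in> I \<and> (\<forall>p\<in>I. \<forall>q\<in>I. p + q \<in> I)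
     \<and> (\<forall>a \<in> carrier (poly_ring V). \<forall>p\<in>I. a * p \<in> I) \<and> (\<forall>e. \<forall>p\<in>I. hpart e p \<in> I)"

text \<open>
  A resolution \<open>\<dots> \<rightarrow> F\<^sub>1 \<rightarrow> F\<^sub>0 \<rightarrow> R/I\<close> is encoded by free modules only: position 0 is
  \<open>R\<close> itself, position \<open>i + 1\<close> is \<open>F\<^sub>i\<close>, and the map \<open>F\<^sub>0 \<rightarrow> R/I\<close> is replaced by a lift
  \<open>F\<^sub>0 \<rightarrow> R\<close>.  All equations in position 0 then hold modulo \<open>I\<close>, those in later positions exactly.
\<close>

definition aug_sub :: "'v set \<Rightarrow> ('v, 'k::field) mpoly set \<Rightarrow> nat \<Rightarrow> ('v, 'k) pvec set" where
  "aug_sub V I i = (if i = 0 then {v \<in> fmod V 1. v 0 \<in> I} else {0})"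

definition gcomplex :: "'v set \<Rightarrow> ('v, 'k::field) mpoly set \<Rightarrow> (nat \<Rightarrow> nat) \<Rightarrow> (nat \<Rightarrow> nat \<Rightarrow> int)
    \<Rightarrow> (nat \<Rightarrow> ('v, 'k) pvec \<Rightarrow> ('v, 'k) pvec) \<Rightarrow> bool" where
  "gcomplex V I n d \<delta> \<longleftrightarrow> n 0 = 1
     \<and> (\<forall>i. ghom V (n (Suc i)) (d (Suc i)) (n i) (d i) (\<delta> i))
     \<and> (\<forall>i. \<forall>v \<in> fmod V (n (Suc (Suc i))). \<delta> i (\<delta> (Suc i) v) \<in> aug_sub V I i)"

text \<open>At position 0 every element of R is a cycle, so exactness there says that F_0 maps onto
  R/I.\<close>

definition cycles :: "'v set \<Rightarrow> ('v, 'k::field) mpoly set \<Rightarrow> (nat \<Rightarrow> nat)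
    \<Rightarrow> (nat \<Rightarrow> ('v, 'k) pvec \<Rightarrow> ('v, 'k) pvec) \<Rightarrow> nat \<Rightarrow> ('v, 'k) pvec set" where
  "cycles V I n \<delta> i = {v \<in> fmod V (n i). \<forall>j. i = Suc j \<longrightarrow> \<delta> j v \<in> aug_sub V I j}"

definition gexact :: "'v set \<Rightarrow> ('v, 'k::field) mpoly set \<Rightarrow> (nat \<Rightarrow> nat)
    \<Rightarrow> (nat \<Rightarrow> ('v, 'k) pvec \<Rightarrow> ('v, 'k) pvec) \<Rightarrow> bool" where
  "gexact V I n \<delta> \<longleftrightarrow>
     (\<forall>i. \<forall>v \<in> cycles V I n \<delta> i. \<exists>w \<in> fmod V (n (Suc i)). v - \<delta> i w \<in> aug_sub V I i)"

text \<open>The normalization of \<open>d 0\<close> is kept out of \<open>gcomplex\<close> because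
  the mapping cone uses complexes shifted by \<open>c\<close>, whose position 0 is R(-c).\<close>

definition gres :: "'v set \<Rightarrow> ('v, 'k::field) mpoly set \<Rightarrow> (nat \<Rightarrow> nat) \<Rightarrow> (nat \<Rightarrow> nat \<Rightarrow> int)
    \<Rightarrow> (nat \<Rightarrow> ('v, 'k) pvec \<Rightarrow> ('v, 'k) pvec) \<Rightarrow> bool" where
  "gres V I n d \<delta> \<longleftrightarrow> gcomplex V I n d \<delta> \<and> gexact V I n \<delta> \<and> d 0 = (\<lambda>_. 0)"

lemma gcomplexD:
  assumes "gcomplex V I n d \<delta>"
  shows "n 0 = 1" "ghom V (n (Suc i)) (d (Suc i)) (n i) (d i) (\<delta> i)"
    "v \<in> fmod V (n (Suc (Suc i))) \<Longrightarrow> \<delta> i (\<delta> (Suc i) v) \<in> aug_sub V I i"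
  using assms by (auto simp: gcomplex_def)

lemma gcomplex_cycles:
  assumes "gcomplex V I n d \<delta>" "v \<in> fmod V (n (Suc i))"
  shows "\<delta> i v \<in> cycles V I n \<delta> i"
  using assms ghomD(1)[OF gcomplexD(2)[OF assms(1)] assms(2)]
  by (auto simp: cycles_def gcomplexD(3))

lemma gsubmod_aug_sub:
  assumes "hideal V I" "gcomplex V I n d \<delta>"
  shows "gsubmod V (n i) (d i) (aug_sub V I i)"
proof (cases "i = 0")
  case True
  have "vpart (d 0) e v \<in> fmod V 1" if "v \<in> fmod V 1" for e and v :: "('a, 'b) pvec"
    by (rule gcomp_fmod[OF vpart_gcomp[OF that]])
  then show ?thesis
    using True assms(1) gcomplexD(1)[OF assms(2)]
    by (auto simp: gsubmod_def aug_sub_def hideal_def fmod_closed vpart_def)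
next
  case False
  then show ?thesis
    by (auto simp: gsubmod_def aug_sub_def fmod_closed vpart_def fun_eq_iff)
qed

text \<open>Comparison theorem: the next map lifts \<open>\<phi> i \<circ> \<epsilon> i\<close>
  through \<open>\<delta> i\<close>, by freeness of the source and exactness of the target. The two
  ideals may differ, so \<open>f0\<close> can be multiplication by a polynomial from R/J to R/I as
  well as the identity.\<close>

lemma chain_map_lift:
  assumes I: "hideal V I" and J: "hideal V J"
    and C: "gcomplex V J m d' \<epsilon>" and D: "gcomplex V I n d \<delta>" and ex: "gexact V I n \<delta>"
    and f0: "ghom V 1 (d' 0) 1 (d 0) f0" "\<And>v. v \<in> aug_sub V J 0 \<Longrightarrow> f0 v \<in> aug_sub V I 0"
  obtains \<phi> where "\<phi> 0 = f0" "\<And>i. ghom V (m i) (d' i) (n i) (d i) (\<phi> i)"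
    "\<And>i v. v \<in> aug_sub V J i \<Longrightarrow> \<phi> i v \<in> aug_sub V I i"
    "\<And>i v. v \<in> fmod V (m (Suc i)) \<Longrightarrow> \<phi> i (\<epsilon> i v) - \<delta> i (\<phi> (Suc i) v) \<in> aug_sub V I i"
proof -
  \<comment> \<open>The invariant that \<open>f\<close> sends cycles to cycles carries the
    recursion: boundaries go to cycles, and exactness of the target then yields the next
    lift.\<close>
  define P where "P = (\<lambda>i f. (i = 0 \<longrightarrow> f = f0) \<and> ghom V (m i) (d' i) (n i) (d i) f
    \<and> (\<forall>v \<in> aug_sub V J i. f v \<in> aug_sub V I i)
    \<and> (\<forall>v \<in> cycles V J m \<epsilon> i. f v \<in> cycles V I n \<delta> i))"
  define Q where "Q = (\<lambda>i f g. \<forall>v \<in> fmod V (m (Suc i)). f (\<epsilon> i v) - \<delta> i (g v) \<in> aug_sub V I i)"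
  have "\<exists>\<phi>. \<forall>i. P i (\<phi> i) \<and> Q i (\<phi> i) (\<phi> (Suc i))"
  proof (rule dependent_nat_choice)
    have "f0 v \<in> fmod V 1" if v: "v \<in> fmod V 1" for v
      using ghomD(1)[OF f0(1) v] .
    then have "P 0 f0"
      using f0 gcomplexD(1)[OF C] gcomplexD(1)[OF D] by (simp add: P_def cycles_def)
    then show "\<exists>f. P 0 f" by (rule exI[of "P 0"])
  next
    fix f i assume "P i f"
    then have f: "ghom V (m i) (d' i) (n i) (d i) f"
      "\<And>v. v \<in> cycles V J m \<epsilon> i \<Longrightarrow> f v \<in> cycles V I n \<delta> i"
      by (auto simp: P_def)
    have B: "gsubmod V (n i) (d i) (aug_sub V I i)"
      by (rule gsubmod_aug_sub[OF I D])
    have "\<exists>w \<in> fmod V (n (Suc i)). f (\<epsilon> i v) - \<delta> i w \<in> aug_sub V I i"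
      if v: "v \<in> fmod V (m (Suc i))" for v
      using ex f(2)[OF gcomplex_cycles[OF C v]] by (simp add: gexact_def)
    then obtain g where g: "ghom V (m (Suc i)) (d' (Suc i)) (n (Suc i)) (d (Suc i)) g"
        "\<And>v. v \<in> fmod V (m (Suc i)) \<Longrightarrow> f (\<epsilon> i v) - \<delta> i (g v) \<in> aug_sub V I i"
      using ghom_lift[OF ghom_compose[OF gcomplexD(2)[OF C] f(1)] gcomplexD(2)[OF D] B] by blast
    have "\<delta> i (g v) \<in> aug_sub V I i" if v: "v \<in> cycles V J m \<epsilon> (Suc i)" for v
    proof -
      have "\<epsilon> i v \<in> aug_sub V J i" "v \<in> fmod V (m (Suc i))"
        using v by (auto simp: cycles_def)
      with \<open>P i f\<close> have "f (\<epsilon> i v) \<in> aug_sub V I i" "f (\<epsilon> i v) - \<delta> i (g v) \<in> aug_sub V I i"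
        using g(2) by (auto simp: P_def)
      then have "f (\<epsilon> i v) - (f (\<epsilon> i v) - \<delta> i (g v)) \<in> aug_sub V I i"
        by (rule gsubmod_diff[OF B])
      then show ?thesis by simp
    qed
    then have "g v \<in> cycles V I n \<delta> (Suc i)" if "v \<in> cycles V J m \<epsilon> (Suc i)" for v
      using that ghomD(1)[OF g(1)] by (auto simp: cycles_def)
    then have "P (Suc i) g"
      using g(1) ghom_0[OF g(1)] by (auto simp: P_def aug_sub_def)
    moreover have "Q i f g"
      using g(2) by (simp add: Q_def)
    ultimately show "\<exists>g. P (Suc i) g \<and> Q i f g" by blast
  qed
  then obtain \<phi> where "\<And>i. P i (\<phi> i)" "\<And>i. Q i (\<phi> i) (\<phi> (Suc i))" by blast
  then show thesis
    by (intro that[of \<phi>]) (auto simp: P_def Q_def)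
qed

text \<open>An endomorphism of a resolution lying over the identity of R is homotopic to the
  identity. Since \<open>\<theta> 0\<close> is the identity itself, the homotopy can start with
  \<open>h 0 = 0\<close>, and no term passing through R appears at position 1.\<close>

lemma chain_homotopy:
  assumes I: "hideal V I" and D: "gcomplex V I n d \<delta>" and ex: "gexact V I n \<delta>"
    and t0: "\<And>v. v \<in> fmod V 1 \<Longrightarrow> \<theta> 0 v = v"
    and t: "\<And>i. ghom V (n i) (d i) (n i) (d i) (\<theta> i)"
    and comm: "\<And>i v. v \<in> fmod V (n (Suc i)) \<Longrightarrow> \<theta> i (\<delta> i v) - \<delta> i (\<theta> (Suc i) v) \<in> aug_sub V I i"
  obtains h where "h 0 = (\<lambda>_. 0)" "\<And>i. ghom V (n i) (d i) (n (Suc i)) (d (Suc i)) (h i)"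
    "\<And>i v. v \<in> fmod V (n (Suc i)) \<Longrightarrow> \<theta> (Suc i) v = v + h i (\<delta> i v) + \<delta> (Suc i) (h (Suc i) v)"
proof -
  \<comment> \<open>The condition on cycles, applied to the boundary \<open>\<delta> i v\<close>,
    makes the defect \<open>u v\<close> below a cycle. As \<open>f\<close> kills
    \<open>aug_sub V I i\<close>, the term \<open>f (\<delta> i v)\<close> vanishes for cycles
    \<open>v\<close> at position \<open>Suc i\<close>, which reproduces the condition there.\<close>
  define P where "P = (\<lambda>i f. (i = 0 \<longrightarrow> f = (\<lambda>_. 0)) \<and> ghom V (n i) (d i) (n (Suc i)) (d (Suc i)) f
    \<and> (\<forall>v \<in> aug_sub V I i. f v = 0)
    \<and> (\<forall>v \<in> cycles V I n \<delta> i. \<theta> i v - v - \<delta> i (f v) \<in> aug_sub V I i))"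
  define Q where "Q = (\<lambda>i f g. \<forall>v \<in> fmod V (n (Suc i)).
    \<theta> (Suc i) v - v - f (\<delta> i v) - \<delta> (Suc i) (g v) \<in> aug_sub V I (Suc i))"
  have B: "gsubmod V (n i) (d i) (aug_sub V I i)" for i
    by (rule gsubmod_aug_sub[OF I D])
  note hom = gcomplexD(2)[OF D]
  have "\<exists>h. \<forall>i. P i (h i) \<and> Q i (h i) (h (Suc i))"
  proof (rule dependent_nat_choice)
    have "\<theta> 0 v - v - \<delta> 0 0 = 0" if "v \<in> cycles V I n \<delta> 0" for v
      using that t0 gcomplexD(1)[OF D] ghom_0[OF hom[of 0]] by (simp add: cycles_def)
    then have "P 0 (\<lambda>_. 0)"
      using gsubmodD(2)[OF B[of 0]] by (simp add: P_def ghom_zero)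
    then show "\<exists>f. P 0 f" by (rule exI[of "P 0"])
  next
    fix f i assume P: "P i f"
    then have f: "ghom V (n i) (d i) (n (Suc i)) (d (Suc i)) f"
      by (simp add: P_def)
    define u where "u = (\<lambda>v. \<theta> (Suc i) v - v - f (\<delta> i v))"
    have u: "ghom V (n (Suc i)) (d (Suc i)) (n (Suc i)) (d (Suc i)) u"
      unfolding u_def by (intro ghom_minus t ghom_id ghom_compose[OF hom f])
    have "\<exists>w \<in> fmod V (n (Suc (Suc i))). u v - \<delta> (Suc i) w \<in> aug_sub V I (Suc i)"
      if v: "v \<in> fmod V (n (Suc i))" for v
    proof -
      have v1: "\<delta> i v \<in> fmod V (n i)" "\<theta> (Suc i) v \<in> fmod V (n (Suc i))"
        using ghomD(1)[OF hom v] ghomD(1)[OF t v] by auto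
      then have "f (\<delta> i v) \<in> fmod V (n (Suc i))"
        using ghomD(1)[OF f] by simp
      then have "\<delta> i (u v) = \<delta> i (\<theta> (Suc i) v) - \<delta> i v - \<delta> i (f (\<delta> i v))"
        using v v1 by (simp add: u_def ghom_diff[OF hom] fmod_closed)
      then have "\<delta> i (u v) = (\<theta> i (\<delta> i v) - \<delta> i v - \<delta> i (f (\<delta> i v)))
          - (\<theta> i (\<delta> i v) - \<delta> i (\<theta> (Suc i) v))"
        by simp
      also have "\<dots> \<in> aug_sub V I i"
      proof (rule gsubmod_diff[OF B _ comm[OF v]])
      show "\<theta> i (\<delta> i v) - \<delta> i v - \<delta> i (f (\<delta> i v)) \<in> aug_sub V I i"
        using P gcomplex_cycles[OF D v] by (simp add: P_def)
    qed
      finally have "u v \<in> cycles V I n \<delta> (Suc i)"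
        using ghomD(1)[OF u v] by (simp add: cycles_def)
      then show ?thesis
        using ex by (simp add: gexact_def)
    qed
    then obtain g where g: "ghom V (n (Suc i)) (d (Suc i)) (n (Suc (Suc i))) (d (Suc (Suc i))) g"
        "\<And>v. v \<in> fmod V (n (Suc i)) \<Longrightarrow> u v - \<delta> (Suc i) (g v) \<in> aug_sub V I (Suc i)"
      using ghom_lift[OF u hom B] by blast
    have "\<theta> (Suc i) v - v - \<delta> (Suc i) (g v) \<in> aug_sub V I (Suc i)"
      if "v \<in> cycles V I n \<delta> (Suc i)" for v
    proof -
      have "v \<in> fmod V (n (Suc i))" "f (\<delta> i v) = 0"
        using that P by (auto simp: cycles_def P_def)
      then show ?thesis using g(2)[of v] by (simp add: u_def)
    qed
    then have "P (Suc i) g"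
      using g(1) ghom_0[OF g(1)] by (auto simp: P_def aug_sub_def)
    moreover have "Q i f g"
      using g(2) by (simp add: Q_def u_def)
    ultimately show "\<exists>g. P (Suc i) g \<and> Q i f g" by blast
  qed
  then obtain h where h: "\<And>i. P i (h i)" "\<And>i. Q i (h i) (h (Suc i))" by blast
  have "\<theta> (Suc i) v = v + h i (\<delta> i v) + \<delta> (Suc i) (h (Suc i) v)" if "v \<in> fmod V (n (Suc i))" for i v
  proof -
    have "\<theta> (Suc i) v - v - h i (\<delta> i v) - \<delta> (Suc i) (h (Suc i) v) = 0"
      using h(2)[of i] that by (simp add: Q_def aug_sub_def)
    then show ?thesis by (simp add: algebra_simps)
  qed
  with h(1) show thesis
    by (intro that[of h]) (auto simp: P_def)
qed


section \<open>Uniqueness of the shifts of a minimal resolution\<close>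

text \<open>Exponents are natural numbers, so \<open>0 = a + b\<close> forces
  \<open>a = 0\<close>.\<close>

lemma lookup_mult_0:
  fixes p q :: "('v, 'k::field) mpoly"
  assumes "Poly_Mapping.lookup p 0 = 0"
  shows "Poly_Mapping.lookup (p * q) 0 = 0"
proof (rule ccontr)
  assume "Poly_Mapping.lookup (p * q) 0 \<noteq> 0"
  then have "0 \<in> Poly_Mapping.keys (p * q)" by (simp add: in_keys_iff)
  then obtain a b where ab: "0 = a + b" "a \<in> Poly_Mapping.keys p"
    using Poly_Mapping.keys_mult[of p q] by blast
  have "a = 0"
  proof (rule poly_mapping_eqI)
    fix x show "Poly_Mapping.lookup a x = Poly_Mapping.lookup 0 x"
      using arg_cong[OF ab(1), of "\<lambda>m. Poly_Mapping.lookup m x"] by (simp add: lookup_add)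
  qed
  with ab(2) assms show False by (simp add: in_keys_iff)
qed

text \<open>Membership of all entries in the irrelevant ideal, expressed by constant terms;
  \<open>irrelevant_ideal_eq\<close> provides the link.\<close>

definition mvec :: "('v, 'k::field) pvec set" where
  "mvec = {v. \<forall>k. Poly_Mapping.lookup (v k) 0 = 0}"

lemma mvec_closed: "0 \<in> mvec" "v \<in> mvec \<Longrightarrow> w \<in> mvec \<Longrightarrow> v + w \<in> mvec"
  "v \<in> mvec \<Longrightarrow> w \<in> mvec \<Longrightarrow> v - w \<in> mvec"
  by (auto simp: mvec_def lookup_add lookup_minus)

lemma ghom_mvec:
  assumes "ghom V n d m d' f" "v \<in> fmod V n" "v \<in> mvec"
  shows "f v \<in> mvec"
  using assms(3)
  by (auto simp: ghom_expand[OF assms(1,2)] mvec_def sum_apply lookup_sum lookup_mult_0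
      intro!: sum.neutral)

text \<open>Only the maps \<open>\<delta> (Suc i)\<close> are constrained: \<open>\<delta> 0\<close>
  is the lift of the augmentation from F_0 to R/I, to which minimality does not refer.\<close>

definition gminimal :: "'v set \<Rightarrow> (nat \<Rightarrow> nat) \<Rightarrow> (nat \<Rightarrow> ('v, 'k::field) pvec \<Rightarrow> ('v, 'k) pvec) \<Rightarrow> bool"
  where "gminimal V n \<delta> \<longleftrightarrow> (\<forall>i. \<forall>v \<in> fmod V (n (Suc (Suc i))). \<delta> (Suc i) v \<in> mvec)"

text \<open>If the degree of \<open>unitv k\<close> is absent from the other resolution, every entry
  of its image under \<open>\<phi>\<close> is homogeneous of nonzero degree, hence without constant
  term, and so is its image under \<open>\<theta>\<close>. The homotopy terms have no constant terms
  either, by minimality, so \<open>unitv k\<close> itself would have none.\<close>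

lemma gminimal_shifts_subset:
  assumes I: "hideal V I" and C: "gres V I m d' \<epsilon>" "gminimal V m \<epsilon>" and D: "gres V I n d \<delta>"
    and k: "k < m (Suc i)"
  shows "\<exists>l < n (Suc i). d (Suc i) l = d' (Suc i) k"
proof (rule ccontr)
  assume neg: "\<not> ?thesis"
  have c: "gcomplex V I m d' \<epsilon>" "gexact V I m \<epsilon>" "gcomplex V I n d \<delta>" "gexact V I n \<delta>"
    "d' 0 = (\<lambda>_. 0)" "d 0 = (\<lambda>_. 0)"
    using C(1) D by (auto simp: gres_def)
  have id0: "ghom V 1 (d' 0) 1 (d 0) (\<lambda>v. v)" "ghom V 1 (d 0) 1 (d' 0) (\<lambda>v. v)"
    using c by (simp_all add: ghom_id)
  obtain \<phi> where p: "\<phi> 0 = (\<lambda>v. v)" "\<And>i. ghom V (m i) (d' i) (n i) (d i) (\<phi> i)"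
    "\<And>i v. v \<in> fmod V (m (Suc i)) \<Longrightarrow> \<phi> i (\<epsilon> i v) - \<delta> i (\<phi> (Suc i) v) \<in> aug_sub V I i"
    using chain_map_lift[OF I I c(1,3,4) id0(1)] by metis
  obtain \<psi> where q: "\<psi> 0 = (\<lambda>v. v)" "\<And>i. ghom V (n i) (d i) (m i) (d' i) (\<psi> i)"
    "\<And>i v. v \<in> aug_sub V I i \<Longrightarrow> \<psi> i v \<in> aug_sub V I i"
    "\<And>i v. v \<in> fmod V (n (Suc i)) \<Longrightarrow> \<psi> i (\<delta> i v) - \<epsilon> i (\<psi> (Suc i) v) \<in> aug_sub V I i"
    using chain_map_lift[OF I I c(3,1,2) id0(2)] by metis
  define \<theta> where "\<theta> = (\<lambda>i v. \<psi> i (\<phi> i v))"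
  have t: "ghom V (m i) (d' i) (m i) (d' i) (\<theta> i)" for i
    unfolding \<theta>_def by (rule ghom_compose[OF p(2) q(2)])
  have comm: "\<theta> i (\<epsilon> i v) - \<epsilon> i (\<theta> (Suc i) v) \<in> aug_sub V I i" if v: "v \<in> fmod V (m (Suc i))" for i v
  proof -
    have v1: "\<phi> (Suc i) v \<in> fmod V (n (Suc i))" "\<epsilon> i v \<in> fmod V (m i)"
      using ghomD(1)[OF p(2) v] ghomD(1)[OF gcomplexD(2)[OF c(1)] v] by auto
    have v2: "\<phi> i (\<epsilon> i v) \<in> fmod V (n i)" "\<delta> i (\<phi> (Suc i) v) \<in> fmod V (n i)"
      using ghomD(1)[OF p(2) v1(2)] ghomD(1)[OF gcomplexD(2)[OF c(3)] v1(1)] by auto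
    have "\<psi> i (\<phi> i (\<epsilon> i v) - \<delta> i (\<phi> (Suc i) v))
        + (\<psi> i (\<delta> i (\<phi> (Suc i) v)) - \<epsilon> i (\<psi> (Suc i) (\<phi> (Suc i) v))) \<in> aug_sub V I i"
      by (intro gsubmodD(3)[OF gsubmod_aug_sub[OF I c(1)]] q v1 p v)
    then show ?thesis
      by (simp add: \<theta>_def ghom_diff[OF q(2) v2])
  qed
  obtain h where h: "h 0 = (\<lambda>_. 0)" "\<And>i. ghom V (m i) (d' i) (m (Suc i)) (d' (Suc i)) (h i)"
    "\<And>i v. v \<in> fmod V (m (Suc i)) \<Longrightarrow> \<theta> (Suc i) v = v + h i (\<epsilon> i v) + \<epsilon> (Suc i) (h (Suc i) v)"
    by (rule chain_homotopy[OF I c(1,2) _ t comm]) (simp_all add: \<theta>_def p(1) q(1))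
  let ?e = "unitv k :: ('a, 'b) pvec"
  have e: "?e \<in> fmod V (m (Suc i))" "?e \<in> gcomp V (m (Suc i)) (d' (Suc i)) (d' (Suc i) k)"
    using k by (auto intro: unitv_fmod unitv_gcomp)
  have "\<phi> (Suc i) ?e \<in> mvec"
    unfolding mvec_def
  proof (intro CollectI allI)
    fix l
    have *: "\<phi> (Suc i) ?e \<in> gcomp V (n (Suc i)) (d (Suc i)) (d' (Suc i) k)"
      by (rule ghomD(4)[OF p(2) e(2)])
    show "Poly_Mapping.lookup (\<phi> (Suc i) ?e l) 0 = 0"
    proof (cases "l < n (Suc i)")
      case True
      then have "d' (Suc i) k - d (Suc i) l \<noteq> 0" using neg by auto
      moreover have "homogeneous (d' (Suc i) k - d (Suc i) l) (\<phi> (Suc i) ?e l)"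
        using * by (simp add: gcomp_def)
      ultimately have "0 \<notin> Poly_Mapping.keys (\<phi> (Suc i) ?e l)"
        by (auto simp: homogeneous_def)
      then show ?thesis by (simp add: in_keys_iff)
    next
      case False
      then show ?thesis using * by (simp add: gcomp_def fmod_def)
    qed
  qed
  then have "\<theta> (Suc i) ?e \<in> mvec"
    unfolding \<theta>_def by (rule ghom_mvec[OF q(2) ghomD(1)[OF p(2) e(1)]])
  \<comment> \<open>For \<open>i = 0\<close> the map \<open>\<epsilon> 0\<close> is the augmentation
    and may have unit entries; there \<open>h 0 = 0\<close> removes the term.\<close>
  moreover have "h i (\<epsilon> i ?e) \<in> mvec"
  proof (cases i)
    case 0
    then show ?thesis by (simp add: h(1) mvec_closed flip: zero_fun_def)
  next
    case (Suc j)
    then have "\<epsilon> i ?e \<in> mvec"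
      using C(2) e(1) by (simp add: gminimal_def)
    then show ?thesis
      by (rule ghom_mvec[OF h(2) ghomD(1)[OF gcomplexD(2)[OF c(1)] e(1)]])
  qed
  moreover have "\<epsilon> (Suc i) (h (Suc i) ?e) \<in> mvec"
    using C(2) ghomD(1)[OF h(2) e(1)] by (simp add: gminimal_def)
  ultimately have "\<theta> (Suc i) ?e - h i (\<epsilon> i ?e) - \<epsilon> (Suc i) (h (Suc i) ?e) \<in> mvec"
    by (intro mvec_closed)
  then have "?e \<in> mvec"
    using h(3)[OF e(1)] by simp
  then show False
    by (auto simp: mvec_def unitv_def dest!: spec[of _ k])
qed


section \<open>Resolutions as augmented complexes\<close>

lemma hidealD:
  assumes "hideal V I"
  shows "p \<in> I \<Longrightarrow> p \<in> carrier (poly_ring V)" "0 \<in> I" "p \<in> I \<Longrightarrow> q \<in> I \<Longrightarrow> p + q \<in> I"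
    "a \<in> carrier (poly_ring V) \<Longrightarrow> p \<in> I \<Longrightarrow> a * p \<in> I" "p \<in> I \<Longrightarrow> hpart e p \<in> I"
  using assms unfolding hideal_def by blast+

lemma hideal_uminus: "hideal V I \<Longrightarrow> p \<in> I \<Longrightarrow> - p \<in> I"
  using hidealD(4)[of V I "- 1" p] by (simp add: ring_closed)

lemma hideal_diff: "hideal V I \<Longrightarrow> p \<in> I \<Longrightarrow> q \<in> I \<Longrightarrow> p - q \<in> I"
  using hidealD(3)[of V I p "- q"] hideal_uminus[of V I q] by simp

section \<open>Cosets of a homogeneous ideal and the module \<open>R/I\<close>\<close>

lemma coset_eq: "I +>\<^bsub>poly_ring V\<^esub> p = (\<lambda>h. h + p) ` I"
  by (auto simp: a_r_coset_def' poly_ring_simps)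

lemma coset_eq_iff:
  assumes I: "hideal V I"
  shows "I +>\<^bsub>poly_ring V\<^esub> p = I +>\<^bsub>poly_ring V\<^esub> q \<longleftrightarrow> p - q \<in> I"
proof
  assume "I +>\<^bsub>poly_ring V\<^esub> p = I +>\<^bsub>poly_ring V\<^esub> q"
  then have "0 + p \<in> (\<lambda>h. h + q) ` I"
    using hidealD(2)[OF I] unfolding coset_eq by blast
  then show "p - q \<in> I" by auto
next
  assume pq: "p - q \<in> I"
  have "h + p \<in> (\<lambda>h. h + q) ` I" if "h \<in> I" for h
    using hidealD(3)[OF I that pq] by (rule rev_image_eqI) simp
  moreover have "h + q \<in> (\<lambda>h. h + p) ` I" if "h \<in> I" for h
    using hideal_diff[OF I that pq] by (rule rev_image_eqI) simp
  ultimately show "I +>\<^bsub>poly_ring V\<^esub> p = I +>\<^bsub>poly_ring V\<^esub> q"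
    unfolding coset_eq by blast
qed

lemma hideal_ideal:
  assumes I: "hideal V I"
  shows "ideal I (poly_ring V)"
proof (rule idealI)
  interpret cring "poly_ring V :: ('a, 'b) mpoly ring" by (rule cring_poly_ring)
  show "ring (poly_ring V :: ('a, 'b) mpoly ring)" ..
  show "subgroup I (add_monoid (poly_ring V))"
  proof (rule add.subgroupI)
    show "I \<noteq> {}" using hidealD(2)[OF I] by blast
    fix p assume p: "p \<in> I"
    then have "\<ominus>\<^bsub>poly_ring V\<^esub> p = - p"
      using hidealD(1)[OF I p] by (intro minus_equality) (auto simp: poly_ring_simps ring_closed)
    then show "\<ominus>\<^bsub>poly_ring V\<^esub> p \<in> I"
      using hideal_uminus[OF I p] by simp
  qed (use hidealD[OF I] in \<open>auto simp: poly_ring_simps\<close>)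
  show "p \<otimes>\<^bsub>poly_ring V\<^esub> q \<in> I" "q \<otimes>\<^bsub>poly_ring V\<^esub> p \<in> I"
    if "p \<in> I" "q \<in> carrier (poly_ring V)" for p q
    using hidealD(4)[OF I that(2,1)] by (simp_all add: poly_ring_simps mult.commute)
qed

lemma quotient_module_carrier:
  "carrier (quotient_module V I) = (\<lambda>p. I +>\<^bsub>poly_ring V\<^esub> p) ` carrier (poly_ring V)"
  by (auto simp: quotient_module_def Let_def FactRing_def A_RCOSETS_def')

lemma quotient_module_simps:
  assumes I: "hideal V I" and p: "p \<in> carrier (poly_ring V)" and q: "q \<in> carrier (poly_ring V)"
  shows "(I +>\<^bsub>poly_ring V\<^esub> p) \<oplus>\<^bsub>quotient_module V I\<^esub> (I +>\<^bsub>poly_ring V\<^esub> q) = I +>\<^bsub>poly_ring V\<^esub> (p + q)"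
    and "p \<odot>\<^bsub>quotient_module V I\<^esub> (I +>\<^bsub>poly_ring V\<^esub> q) = I +>\<^bsub>poly_ring V\<^esub> (p * q)"
proof -
  interpret ideal I "poly_ring V" by (rule hideal_ideal[OF I])
  show "(I +>\<^bsub>poly_ring V\<^esub> p) \<oplus>\<^bsub>quotient_module V I\<^esub> (I +>\<^bsub>poly_ring V\<^esub> q) = I +>\<^bsub>poly_ring V\<^esub> (p + q)"
    using p q a_rcos_sum[of p q] by (simp add: quotient_module_def Let_def FactRing_def poly_ring_simps)
  show "p \<odot>\<^bsub>quotient_module V I\<^esub> (I +>\<^bsub>poly_ring V\<^esub> q) = I +>\<^bsub>poly_ring V\<^esub> (p * q)"
    using p q rcoset_mult_add[of p q] by (simp add: quotient_module_def Let_def FactRing_def poly_ring_simps)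
qed

lemma quotient_module_zero:
  assumes "hideal V I"
  shows "\<zero>\<^bsub>quotient_module V I\<^esub> = I +>\<^bsub>poly_ring V\<^esub> 0"
  by (simp add: quotient_module_def Let_def FactRing_def coset_eq)

lemma free_module_simps:
  "add (free_module V n) v w = v + w" "smult (free_module V n) a v = smul a v"
  "zero (free_module V n) = 0"
  by (auto simp: free_module_def)

lemma linear_maps_ghom:
  "(\<forall>e. f ` free_component V n d e \<subseteq> free_component V m d' e) \<and>
     f \<in> linear_maps (poly_ring V) (free_module V n) (free_module V m) \<longleftrightarrow> ghom V n d m d' f"
  by (auto simp: linear_maps_def ghom_def carrier_free_module free_component_eq free_module_simps)

lemma in_fmod_1: "v \<in> fmod V 1 \<longleftrightarrow> v 0 \<in> carrier (poly_ring V) \<and> (\<forall>k>0. v k = 0)"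
proof -
  have "v k \<in> carrier (poly_ring V)" if "v 0 \<in> carrier (poly_ring V)" "\<forall>k>0. v k = 0" for k
    using that by (cases "k = 0") (auto simp: ring_closed)
  then show ?thesis by (auto simp: fmod_def Suc_le_eq)
qed

text \<open>Identifies R with the free module of rank 1 that occupies position 0.\<close>

definition scalarv :: "('v, 'k::field) mpoly \<Rightarrow> ('v, 'k) pvec" where
  "scalarv p = (\<lambda>j. if j = 0 then p else 0)"

lemma scalarv_0 [simp]: "scalarv p 0 = p"
  by (simp add: scalarv_def)

lemma scalarv_fmod: "p \<in> carrier (poly_ring V) \<Longrightarrow> scalarv p \<in> fmod V 1"
  unfolding in_fmod_1 by (simp add: scalarv_def)

lemma scalarv_gcomp:
  "p \<in> carrier (poly_ring V) \<Longrightarrow> homogeneous e p \<Longrightarrow> scalarv p \<in> gcomp V 1 (\<lambda>_. 0) e"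
  unfolding gcomp_def by (intro CollectI conjI scalarv_fmod) (auto simp: scalarv_def)

lemma fmod_1_eq: "v \<in> fmod V 1 \<Longrightarrow> v = scalarv (v 0)"
  unfolding in_fmod_1 by (auto simp: scalarv_def)

text \<open>The lift \<open>a\<close> of the augmentation exists because
  \<open>augm C (unitv k)\<close> lies in the component of degree \<open>shift C 0 k\<close> of R/I
  and so has a homogeneous representative \<open>p k\<close> of that degree. The kernel of
  \<open>augm C\<close> is then the preimage of \<open>I\<close> under \<open>a\<close>.\<close>

lemma gres_of_resolution:
  assumes I: "hideal V I" and C: "is_graded_free_resolution V I C"
  obtains a where "gres V I (case_nat 1 (frank C)) (case_nat (\<lambda>_. 0) (shift C)) (case_nat a (bdry C))"
proof -
  define N where "N = frank C 0"
  note defs = C[unfolded is_graded_free_resolution_def Let_def]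
  have lin: "augm C \<in> linear_maps (poly_ring V) (free_module V N) (quotient_module V I)"
    and grd: "\<And>e. augm C ` free_component V N (shift C 0) e \<subseteq> quotient_component V I e"
    and bd: "\<And>i. ghom V (frank C (Suc i)) (shift C (Suc i)) (frank C i) (shift C i) (bdry C i)"
    and sur: "augm C ` fmod V N = carrier (quotient_module V I)"
    and ker0: "{v \<in> fmod V N. augm C v = \<zero>\<^bsub>quotient_module V I\<^esub>} = bdry C 0 ` fmod V (frank C 1)"
    and ker: "\<And>i. {v \<in> fmod V (frank C (Suc i)). bdry C i v = 0}
        = bdry C (Suc i) ` fmod V (frank C (Suc (Suc i)))"
    using defs by (auto simp: linear_maps_ghom[symmetric] N_def a_kernel_def' carrier_free_module free_module_simps)
  have "\<exists>p. p \<in> carrier (poly_ring V) \<and> homogeneous (shift C 0 k) p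
      \<and> augm C (unitv k) = I +>\<^bsub>poly_ring V\<^esub> p" if k: "k < N" for k
    using grd[of "shift C 0 k"] unitv_gcomp[OF k, where d = "shift C 0" and V = V]
    unfolding free_component_eq quotient_component_def by blast
  then obtain p where p: "\<And>k. k < N \<Longrightarrow> p k \<in> carrier (poly_ring V)"
      "\<And>k. k < N \<Longrightarrow> homogeneous (shift C 0 k) (p k)"
      "\<And>k. k < N \<Longrightarrow> augm C (unitv k) = I +>\<^bsub>poly_ring V\<^esub> p k"
    by metis
  define a where "a = (\<lambda>v :: ('a, 'b) pvec. \<Sum>k<N. smul (v k) (scalarv (p k)))"
  have a: "ghom V N (shift C 0) 1 (\<lambda>_. 0) a"
    unfolding a_def by (intro ghom_of_basis scalarv_gcomp p)
  have add: "augm C (v + w) = augm C v \<oplus>\<^bsub>quotient_module V I\<^esub> augm C w"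
    if "v \<in> fmod V N" "w \<in> fmod V N" for v w
    using lin that by (auto simp: linear_maps_def carrier_free_module free_module_simps)
  have sca: "augm C (smul b v) = b \<odot>\<^bsub>quotient_module V I\<^esub> augm C v"
    if "b \<in> carrier (poly_ring V)" "v \<in> fmod V N" for b v
    using lin that by (auto simp: linear_maps_def carrier_free_module free_module_simps)
  have aug: "augm C v = I +>\<^bsub>poly_ring V\<^esub> a v 0" if v: "v \<in> fmod V N" for v
  proof -
    have vk: "v k \<in> carrier (poly_ring V)" for k
      using v by (simp add: fmod_def)
    have "augm C (\<Sum>k<M. smul (v k) (unitv k)) = I +>\<^bsub>poly_ring V\<^esub> (\<Sum>k<M. v k * p k)"
      if "M \<le> N" for M
      using that
    proof (induction M)
      case 0
      \<comment> \<open>\<open>linear_maps\<close> says nothing about zero; the value is obtained by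
        writing the zero vector as its multiple by the scalar 0.\<close>
      have "augm C 0 \<in> carrier (quotient_module V I)"
        using sur fmod_closed(1) by blast
      then obtain q where q: "q \<in> carrier (poly_ring V)" "augm C 0 = I +>\<^bsub>poly_ring V\<^esub> q"
        by (auto simp: quotient_module_carrier)
      have "augm C 0 = augm C (smul 0 0)" by (simp add: smul_def zero_fun_def)
      also have "\<dots> = I +>\<^bsub>poly_ring V\<^esub> 0"
        using sca[OF ring_closed(1) fmod_closed(1)] quotient_module_simps(2)[OF I ring_closed(1) q(1)] q(2)
        by simp
      finally show ?case
        by (simp only: lessThan_0 sum.empty)
    next
      case (Suc M)
      then have M: "M < N" by simp
      have "(\<Sum>k<M. smul (v k) (unitv k)) \<in> fmod V N"
        using M by (intro fmod_sum_closed fmod_closed vk unitv_fmod) auto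
      moreover have "smul (v M) (unitv M) \<in> fmod V N"
        by (intro fmod_closed vk unitv_fmod M)
      moreover have "(\<Sum>k<M. v k * p k) \<in> carrier (poly_ring V)"
        using M by (intro ring_closed vk p) auto
      ultimately show ?case
        using Suc.IH M
        by (simp only: sum.lessThan_Suc add sca[OF vk unitv_fmod[OF M]] p(3)[OF M]
            quotient_module_simps[OF I] vk p(1) ring_closed less_imp_le)
    qed
    from this[of N] show ?thesis
      using fmod_expand[OF v] by (simp add: a_def sum_apply)
  qed
  have zero_iff: "augm C v = \<zero>\<^bsub>quotient_module V I\<^esub> \<longleftrightarrow> a v \<in> aug_sub V I 0" if v: "v \<in> fmod V N" for v
    using ghomD(1)[OF a v] by (simp add: aug[OF v] quotient_module_zero[OF I] coset_eq_iff[OF I] aug_sub_def)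
  let ?n = "case_nat 1 (frank C)" and ?d = "case_nat (\<lambda>_. 0) (shift C)" and ?D = "case_nat a (bdry C)"
  have "gcomplex V I ?n ?d ?D"
    unfolding gcomplex_def
  proof (intro conjI allI ballI)
    show "ghom V (?n (Suc i)) (?d (Suc i)) (?n i) (?d i) (?D i)" for i
      using a bd by (cases i) (auto simp: N_def)
    fix i and v :: "('a, 'b) pvec" assume "v \<in> fmod V (?n (Suc (Suc i)))"
    then have v: "v \<in> fmod V (frank C (Suc i))" by simp
    show "?D i (?D (Suc i) v) \<in> aug_sub V I i"
    proof (cases i)
      case 0
      then have "bdry C 0 v \<in> {v \<in> fmod V N. augm C v = \<zero>\<^bsub>quotient_module V I\<^esub>}"
        using v ker0 by simp
      then have "a (bdry C 0 v) \<in> aug_sub V I 0"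
        using zero_iff by blast
      then show ?thesis using 0 by simp
    next
      case (Suc j)
      then have "bdry C (Suc j) v \<in> {v \<in> fmod V (frank C (Suc j)). bdry C j v = 0}"
        using v ker[of j] by simp
      then show ?thesis using Suc by (simp add: aug_sub_def)
    qed
  qed simp
  moreover have "gexact V I ?n ?D"
    unfolding gexact_def
  proof (intro allI ballI)
    fix i v assume "v \<in> cycles V I ?n ?D i"
    then have v: "v \<in> fmod V (?n i)" "\<And>j. i = Suc j \<Longrightarrow> ?D j v \<in> aug_sub V I j"
      unfolding cycles_def by blast+
    consider "i = 0" | "i = 1" | j where "i = Suc (Suc j)"
      by (metis One_nat_def nat.exhaust)
    then show "\<exists>w \<in> fmod V (?n (Suc i)). v - ?D i w \<in> aug_sub V I i"
    proof cases
      case 1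
      then have "v 0 \<in> carrier (poly_ring V)" using v(1) by (simp add: in_fmod_1[simplified])
      then have "I +>\<^bsub>poly_ring V\<^esub> v 0 \<in> augm C ` fmod V N"
        by (simp add: sur quotient_module_carrier)
      then obtain w where w: "w \<in> fmod V N" "I +>\<^bsub>poly_ring V\<^esub> v 0 = augm C w" by blast
      then have "v 0 - a w 0 \<in> I"
        by (simp add: aug coset_eq_iff[OF I])
      then have "v - a w \<in> aug_sub V I 0"
        using v(1) ghomD(1)[OF a w(1)] 1 by (simp add: aug_sub_def fmod_closed)
      then show ?thesis using w(1) 1 by (auto simp: N_def)
    next
      case 2
      then have "v \<in> {v \<in> fmod V N. augm C v = \<zero>\<^bsub>quotient_module V I\<^esub>}"
        using v(1) v(2)[of 0] zero_iff by (simp add: N_def)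
      then obtain w where "w \<in> fmod V (frank C 1)" "v = bdry C 0 w"
        unfolding ker0 by blast
      then show ?thesis using 2 by (auto simp: aug_sub_def)
    next
      case (3 j)
      then have "v \<in> {v \<in> fmod V (frank C (Suc j)). bdry C j v = 0}"
        using v(1) v(2)[of "Suc j"] by (simp add: aug_sub_def)
      then obtain w where "w \<in> fmod V (frank C (Suc (Suc j)))" "v = bdry C (Suc j) w"
        unfolding ker by blast
      then show ?thesis using 3 by (auto simp: aug_sub_def)
    qed
  qed
  ultimately have "gres V I ?n ?d ?D"
    by (simp add: gres_def)
  then show thesis by (rule that)
qed

text \<open>The augmentation is the coset of \<open>\<delta> 0\<close>. Exactness at position 0
  becomes surjectivity onto R/I, and exactness at position \<open>Suc i\<close> becomes exactness at
  F_i.\<close>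

lemma resolution_of_gres:
  assumes I: "hideal V I" and G: "gres V I n d \<delta>"
  obtains C where "is_graded_free_resolution V I C"
    "frank C = (\<lambda>i. n (Suc i))" "shift C = (\<lambda>i. d (Suc i))" "bdry C = (\<lambda>i. \<delta> (Suc i))"
proof -
  define C where "C = \<lparr>frank = (\<lambda>i. n (Suc i)), shift = (\<lambda>i. d (Suc i)), bdry = (\<lambda>i. \<delta> (Suc i)),
    augm = (\<lambda>v. I +>\<^bsub>poly_ring V\<^esub> \<delta> 0 v 0)\<rparr>"
  have g: "gcomplex V I n d \<delta>" "gexact V I n \<delta>" "d 0 = (\<lambda>_. 0)"
    using G by (auto simp: gres_def)
  note hom = gcomplexD(2)[OF g(1)]
  have hom0: "ghom V (n 1) (d 1) 1 (\<lambda>_. 0) (\<delta> 0)"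
    using hom[of 0] gcomplexD(1)[OF g(1)] g(3) by simp
  have P0: "\<delta> 0 v 0 \<in> carrier (poly_ring V)" if "v \<in> fmod V (n 1)" for v
    using ghomD(1)[OF hom0 that] by (simp add: fmod_def)
  have aug0: "I +>\<^bsub>poly_ring V\<^esub> \<delta> 0 v 0 = \<zero>\<^bsub>quotient_module V I\<^esub> \<longleftrightarrow> \<delta> 0 v \<in> aug_sub V I 0"
    if "v \<in> fmod V (n 1)" for v
    using ghomD(1)[OF hom0 that]
    by (simp add: quotient_module_zero[OF I] coset_eq_iff[OF I] aug_sub_def)
  have bd: "(\<forall>e. bdry C i ` free_component V (frank C (Suc i)) (shift C (Suc i)) e
        \<subseteq> free_component V (frank C i) (shift C i) e) \<and>
      bdry C i \<in> linear_maps (poly_ring V) (free_module V (frank C (Suc i))) (free_module V (frank C i))" for i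
    unfolding linear_maps_ghom using hom[of "Suc i"] by (simp add: C_def)
  have "is_graded_free_resolution V I C"
    unfolding is_graded_free_resolution_def Let_def
  proof (intro conjI allI)
    show "augm C \<in> linear_maps (poly_ring V) (free_module V (frank C 0)) (quotient_module V I)"
      using P0 ghomD(2,3)[OF hom0]
      by (auto simp: linear_maps_def C_def carrier_free_module free_module_simps
          quotient_module_carrier quotient_module_simps[OF I])
    show "augm C ` free_component V (frank C 0) (shift C 0) e \<subseteq> quotient_component V I e" for e
    proof
      fix X assume "X \<in> augm C ` free_component V (frank C 0) (shift C 0) e"
      then obtain v where v: "v \<in> gcomp V (n 1) (d 1) e" "X = I +>\<^bsub>poly_ring V\<^esub> \<delta> 0 v 0"
        by (auto simp: C_def free_component_eq)
      then show "X \<in> quotient_component V I e"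
        using ghomD(4)[OF hom0 v(1)] P0[OF gcomp_fmod[OF v(1)]]
        by (auto simp: quotient_component_def gcomp_def)
    qed
    show "bdry C i \<in> linear_maps (poly_ring V) (free_module V (frank C (Suc i))) (free_module V (frank C i))"
      "bdry C i ` free_component V (frank C (Suc i)) (shift C (Suc i)) e
        \<subseteq> free_component V (frank C i) (shift C i) e" for i e
      using bd[of i] by blast+
    show "augm C ` carrier (free_module V (frank C 0)) = carrier (quotient_module V I)"
    proof
      show "augm C ` carrier (free_module V (frank C 0)) \<subseteq> carrier (quotient_module V I)"
        using P0 by (auto simp: C_def carrier_free_module quotient_module_carrier)
      show "carrier (quotient_module V I) \<subseteq> augm C ` carrier (free_module V (frank C 0))"
      proof
        fix X assume "X \<in> carrier (quotient_module V I)"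
        then obtain p where p: "p \<in> carrier (poly_ring V)" "X = I +>\<^bsub>poly_ring V\<^esub> p"
          by (auto simp: quotient_module_carrier)
        then have "scalarv p \<in> cycles V I n \<delta> 0"
          using scalarv_fmod gcomplexD(1)[OF g(1)] by (simp add: cycles_def)
        then obtain w where w: "w \<in> fmod V (n 1)" "scalarv p - \<delta> 0 w \<in> aug_sub V I 0"
          using g(2) unfolding gexact_def One_nat_def by blast
        then have "X = I +>\<^bsub>poly_ring V\<^esub> \<delta> 0 w 0"
          by (simp add: p(2) coset_eq_iff[OF I] aug_sub_def)
        then show "X \<in> augm C ` carrier (free_module V (frank C 0))"
          using w(1) by (simp add: C_def carrier_free_module)
      qed
    qed
    show "a_kernel (free_module V (frank C 0)) (quotient_module V I) (augm C)
        = bdry C 0 ` carrier (free_module V (frank C 1))"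
    proof
      show "bdry C 0 ` carrier (free_module V (frank C 1))
          \<subseteq> a_kernel (free_module V (frank C 0)) (quotient_module V I) (augm C)"
        using gcomplexD(3)[OF g(1), of _ 0] ghomD(1)[OF hom[of 1]] aug0
        by (auto simp: C_def a_kernel_def' carrier_free_module)
      show "a_kernel (free_module V (frank C 0)) (quotient_module V I) (augm C)
          \<subseteq> bdry C 0 ` carrier (free_module V (frank C 1))"
      proof
        fix v assume "v \<in> a_kernel (free_module V (frank C 0)) (quotient_module V I) (augm C)"
        then have "v \<in> fmod V (n 1)" "I +>\<^bsub>poly_ring V\<^esub> \<delta> 0 v 0 = \<zero>\<^bsub>quotient_module V I\<^esub>"
          by (simp_all add: C_def a_kernel_def' carrier_free_module)
        then have "v \<in> cycles V I n \<delta> 1"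
          using aug0[of v] by (auto simp: cycles_def)
        then obtain w where "w \<in> fmod V (n (Suc 1))" "v - \<delta> 1 w \<in> aug_sub V I 1"
          using g(2) unfolding gexact_def by blast
        then show "v \<in> bdry C 0 ` carrier (free_module V (frank C 1))"
          by (auto simp: C_def carrier_free_module aug_sub_def)
      qed
    qed
    show "a_kernel (free_module V (frank C (Suc i))) (free_module V (frank C i)) (bdry C i)
        = bdry C (Suc i) ` carrier (free_module V (frank C (Suc (Suc i))))" for i
    proof
      show "bdry C (Suc i) ` carrier (free_module V (frank C (Suc (Suc i))))
          \<subseteq> a_kernel (free_module V (frank C (Suc i))) (free_module V (frank C i)) (bdry C i)"
        using gcomplexD(3)[OF g(1), of _ "Suc i"] ghomD(1)[OF hom[of "Suc (Suc i)"]]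
        by (auto simp: C_def a_kernel_def' carrier_free_module free_module_simps aug_sub_def)
      show "a_kernel (free_module V (frank C (Suc i))) (free_module V (frank C i)) (bdry C i)
          \<subseteq> bdry C (Suc i) ` carrier (free_module V (frank C (Suc (Suc i))))"
      proof
        fix v assume "v \<in> a_kernel (free_module V (frank C (Suc i))) (free_module V (frank C i)) (bdry C i)"
        then have "v \<in> cycles V I n \<delta> (Suc (Suc i))"
          by (simp add: C_def a_kernel_def' carrier_free_module free_module_simps cycles_def aug_sub_def)
        then obtain w where "w \<in> fmod V (n (Suc (Suc (Suc i))))"
            "v - \<delta> (Suc (Suc i)) w \<in> aug_sub V I (Suc (Suc i))"
          using g(2) unfolding gexact_def by blast
        then show "v \<in> bdry C (Suc i) ` carrier (free_module V (frank C (Suc (Suc i))))"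
          by (auto simp: C_def carrier_free_module aug_sub_def)
      qed
    qed
  qed
  then show thesis by (rule that) (simp_all add: C_def)
qed


section \<open>The mapping cone of multiplication by a homogeneous polynomial\<close>

text \<open>Direct sums are realised by concatenating coordinates: \<open>cpart\<close> and
  \<open>bpart\<close> are the two projections, \<open>vjoin\<close> the pairing. In the cone, the
  first \<open>N\<close> coordinates belong to the resolution of R/I, the others to the shifted one
  of R/J.\<close>

definition cpart :: "nat \<Rightarrow> ('v, 'k::field) pvec \<Rightarrow> ('v, 'k) pvec" where
  "cpart N v = (\<lambda>k. if k < N then v k else 0)"

definition bpart :: "nat \<Rightarrow> ('v, 'k::field) pvec \<Rightarrow> ('v, 'k) pvec" where
  "bpart N v = (\<lambda>k. v (N + k))"

definition vjoin :: "nat \<Rightarrow> ('v, 'k::field) pvec \<Rightarrow> ('v, 'k) pvec \<Rightarrow> ('v, 'k) pvec" where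
  "vjoin N c b = (\<lambda>k. if k < N then c k else b (k - N))"

definition dsum :: "nat \<Rightarrow> (nat \<Rightarrow> int) \<Rightarrow> (nat \<Rightarrow> int) \<Rightarrow> nat \<Rightarrow> int" where
  "dsum N d d' = (\<lambda>k. if k < N then d k else d' (k - N))"

lemma ghom_cpart: "ghom V (N + M) (dsum N d d') N d (cpart N)"
proof -
  have "homogeneous (e - d k) (cpart N v k)"
    if "\<forall>k. homogeneous (e - dsum N d d' k) (v k)" for e k and v :: "('a, 'b) pvec"
    using spec[OF that, of k] by (cases "k < N") (simp_all add: cpart_def dsum_def)
  then show ?thesis
    by (auto simp: ghom_def gcomp_def fmod_def cpart_def fun_eq_iff ring_closed)
qed

lemma ghom_bpart: "ghom V (N + M) (dsum N d d') M d' (bpart N)"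
proof -
  have "homogeneous (e - d' k) (bpart N v k)"
    if "\<forall>k. homogeneous (e - dsum N d d' k) (v k)" for e k and v :: "('a, 'b) pvec"
    using spec[OF that, of "N + k"] by (simp add: bpart_def dsum_def)
  then show ?thesis
    by (auto simp: ghom_def gcomp_def fmod_def bpart_def fun_eq_iff)
qed

lemma vjoin_fmod: "c \<in> fmod V N \<Longrightarrow> b \<in> fmod V M \<Longrightarrow> vjoin N c b \<in> fmod V (N + M)"
  by (auto simp: fmod_def vjoin_def)

lemma ghom_vjoin:
  assumes f: "ghom V n dn N d f" and g: "ghom V n dn M d' g"
  shows "ghom V n dn (N + M) (dsum N d d') (\<lambda>v. vjoin N (f v) (g v))"
  unfolding ghom_def
proof (intro conjI allI ballI)
  show "vjoin N (f v) (g v) \<in> fmod V (N + M)" if "v \<in> fmod V n" for v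
    using that by (intro vjoin_fmod ghomD(1)[OF f] ghomD(1)[OF g])
  show "vjoin N (f v) (g v) \<in> gcomp V (N + M) (dsum N d d') e" if "v \<in> gcomp V n dn e" for v e
    using ghomD(4)[OF f that] ghomD(4)[OF g that] vjoin_fmod[of "f v" V N "g v" M]
    by (auto simp: gcomp_def vjoin_def dsum_def)
  show "vjoin N (f (v + w)) (g (v + w)) = vjoin N (f v) (g v) + vjoin N (f w) (g w)"
    if "v \<in> fmod V n" "w \<in> fmod V n" for v w
    by (simp add: ghomD(2)[OF f that] ghomD(2)[OF g that] vjoin_def fun_eq_iff)
  show "vjoin N (f (smul a v)) (g (smul a v)) = smul a (vjoin N (f v) (g v))"
    if "a \<in> carrier (poly_ring V)" "v \<in> fmod V n" for a v
    by (simp add: ghomD(3)[OF f that] ghomD(3)[OF g that] vjoin_def fun_eq_iff)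
qed

lemma cpart_vjoin: "c \<in> fmod V N \<Longrightarrow> cpart N (vjoin N c b) = c"
  by (auto simp: fmod_def cpart_def vjoin_def fun_eq_iff)

lemma bpart_vjoin: "bpart N (vjoin N c b) = b"
  by (simp add: bpart_def vjoin_def)

lemma vjoin_parts: "vjoin N (cpart N v) (bpart N v) = v"
  by (auto simp: bpart_def cpart_def vjoin_def)

lemma vjoin_0: "c \<in> fmod V N \<Longrightarrow> vjoin N c 0 = c"
  by (auto simp: fmod_def vjoin_def fun_eq_iff)

lemma cpart_id: "c \<in> fmod V N \<Longrightarrow> cpart N c = c"
  by (auto simp: fmod_def cpart_def fun_eq_iff)

lemma vjoin_eq_0:
  assumes c: "c \<in> fmod V N" and 0: "vjoin N c b = 0"
  shows "c = 0" "b = 0"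
proof -
  have "c = cpart N 0" "b = bpart N 0"
    using cpart_vjoin[OF c, of b] bpart_vjoin[of N c b] unfolding 0 by simp_all
  then show "c = 0" "b = 0"
    by (simp_all add: cpart_def bpart_def fun_eq_iff)
qed

lemma cpart_fmod: "v \<in> fmod V (N + M) \<Longrightarrow> cpart N v \<in> fmod V N"
  by (rule ghomD(1)[OF ghom_cpart])

lemma bpart_fmod: "v \<in> fmod V (N + M) \<Longrightarrow> bpart N v \<in> fmod V M"
  by (rule ghomD(1)[OF ghom_bpart])

lemma ghom_smul:
  assumes "f \<in> carrier (poly_ring V)" "homogeneous c f"
  shows "ghom V n (\<lambda>k. d k + c) n d (smul f)"
proof -
  have "smul f v \<in> gcomp V n d e" if "v \<in> gcomp V n (\<lambda>k. d k + c) e" for v e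
  proof -
    have "v \<in> gcomp V n d (e - c)"
      using that by (simp add: gcomp_def algebra_simps)
    then show ?thesis
      using smul_gcomp[OF assms] by fastforce
  qed
  then show ?thesis
    using assms by (auto simp: ghom_def fmod_closed fun_eq_iff algebra_simps)
qed

text \<open>Position \<open>Suc j\<close> joins position \<open>Suc j\<close> of the first complex
  with position \<open>j\<close> of the second. For \<open>j = 0\<close> the latter would be the
  copy of R that encodes the target R/J, not a module of its resolution, and is left out.\<close>

definition cone_rank :: "(nat \<Rightarrow> nat) \<Rightarrow> (nat \<Rightarrow> nat) \<Rightarrow> nat \<Rightarrow> nat" where
  "cone_rank n m i = (case i of 0 \<Rightarrow> n 0 | Suc j \<Rightarrow> n (Suc j) + (if j = 0 then 0 else m j))"

definition cone_shift :: "(nat \<Rightarrow> nat) \<Rightarrow> (nat \<Rightarrow> nat \<Rightarrow> int) \<Rightarrow> (nat \<Rightarrow> nat \<Rightarrow> int) \<Rightarrow> int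
    \<Rightarrow> nat \<Rightarrow> nat \<Rightarrow> int" where
  "cone_shift n d d' c i =
     (case i of 0 \<Rightarrow> d 0 | Suc j \<Rightarrow> dsum (n (Suc j)) (d (Suc j)) (\<lambda>k. d' j k + c))"

lemma cone_rank_simps [simp]:
  "cone_rank n m 0 = n 0" "cone_rank n m (Suc 0) = n (Suc 0)"
  "cone_rank n m (Suc (Suc j)) = n (Suc (Suc j)) + m (Suc j)"
  by (simp_all add: cone_rank_def)

lemma cone_shift_simps [simp]:
  "cone_shift n d d' c 0 = d 0"
  "cone_shift n d d' c (Suc j) = dsum (n (Suc j)) (d (Suc j)) (\<lambda>k. d' j k + c)"
  by (simp_all add: cone_shift_def)

text \<open>The cone differential sends (x, y) to (\<open>\<delta>\<close> x + \<open>\<phi>\<close>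
  y, - \<open>\<epsilon>\<close> y); for \<open>j = 0\<close> the second target is absent. The sign
  is written \<open>0 - \<dots>\<close> to fit \<open>ghom_minus\<close>.\<close>

definition cone_bdry :: "(nat \<Rightarrow> nat) \<Rightarrow> (nat \<Rightarrow> ('v, 'k::field) pvec \<Rightarrow> ('v, 'k) pvec)
    \<Rightarrow> (nat \<Rightarrow> ('v, 'k) pvec \<Rightarrow> ('v, 'k) pvec) \<Rightarrow> (nat \<Rightarrow> ('v, 'k) pvec \<Rightarrow> ('v, 'k) pvec)
    \<Rightarrow> nat \<Rightarrow> ('v, 'k) pvec \<Rightarrow> ('v, 'k) pvec" where
  "cone_bdry n \<delta> \<epsilon> \<phi> i v = (case i of
     0 \<Rightarrow> \<delta> 0 (cpart (n (Suc 0)) v)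
   | Suc j \<Rightarrow> vjoin (n (Suc j))
       (\<delta> (Suc j) (cpart (n (Suc (Suc j))) v) + \<phi> (Suc j) (bpart (n (Suc (Suc j))) v))
       (if j = 0 then 0 else 0 - \<epsilon> j (bpart (n (Suc (Suc j))) v)))"

text \<open>Multiplication by \<open>f\<close> from (R/J)(-c) to R/I is injective, as
  \<open>J\<close> is the colon ideal of \<open>I\<close> by \<open>f\<close>, and has cokernel R/K
  with \<open>K\<close> generated by \<open>I\<close> and \<open>f\<close>. Lifting it to the
  resolutions and taking the cone therefore resolves R/K.\<close>

lemma gres_cone:
  assumes I: "hideal V I" and J: "hideal V J" and f: "f \<in> carrier (poly_ring V)" "homogeneous c f"
    and colon: "\<And>p. p \<in> carrier (poly_ring V) \<Longrightarrow> p \<in> J \<longleftrightarrow> f * p \<in> I"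
    and K: "K = {p \<in> carrier (poly_ring V). \<exists>q \<in> carrier (poly_ring V). p - f * q \<in> I}"
    and G: "gres V I n d \<delta>" and H: "gres V J m d' \<epsilon>"
  obtains \<Delta> where "gres V K (cone_rank n m) (cone_shift n d d' c) \<Delta>"
proof -
  have g: "gcomplex V I n d \<delta>" "gexact V I n \<delta>" "d 0 = (\<lambda>_. 0)"
    using G by (auto simp: gres_def)
  have h: "gcomplex V J m d' \<epsilon>" "gexact V J m \<epsilon>" "d' 0 = (\<lambda>_. 0)"
    using H by (auto simp: gres_def)
  have h': "gcomplex V J m (\<lambda>i k. d' i k + c) \<epsilon>"
    using h(1) by (auto simp: gcomplex_def intro: ghom_shift)
  note dhom = gcomplexD(2)[OF g(1)] and ehom = gcomplexD(2)[OF h']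
  note n0 = gcomplexD(1)[OF g(1)] and m0 = gcomplexD(1)[OF h(1)]
  have sm: "ghom V 1 (\<lambda>k. d' 0 k + c) 1 (d 0) (smul f)"
    using ghom_smul[OF f, of 1 "\<lambda>_. 0"] g(3) h(3) by simp
  \<comment> \<open>From right to left this makes multiplication by \<open>f\<close> well defined
    from R/J to R/I; from left to right it makes it injective.\<close>
  have smJ: "smul f v \<in> aug_sub V I 0 \<longleftrightarrow> v \<in> aug_sub V J 0" if "v \<in> fmod V 1" for v
    using that fmod_closed(5)[OF f(1) that] colon[of "v 0"] by (simp add: aug_sub_def fmod_def)
  obtain \<phi> where p: "\<phi> 0 = smul f" "\<And>i. ghom V (m i) (\<lambda>k. d' i k + c) (n i) (d i) (\<phi> i)"
    "\<And>i v. v \<in> fmod V (m (Suc i)) \<Longrightarrow> \<phi> i (\<epsilon> i v) - \<delta> i (\<phi> (Suc i) v) \<in> aug_sub V I i"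
  proof (rule chain_map_lift[OF I J h' g(1,2) sm])
    show "smul f v \<in> aug_sub V I 0" if "v \<in> aug_sub V J 0" for v
      using smJ[of v] that by (simp add: aug_sub_def)
  qed (erule that, assumption+)
  have B: "gsubmod V (n i) (d i) (aug_sub V I i)" for i
    by (rule gsubmod_aug_sub[OF I g(1)])
  have p0: "smul f (\<epsilon> 0 b) - \<delta> 0 (\<phi> (Suc 0) b) \<in> aug_sub V I 0" if "b \<in> fmod V (m (Suc 0))" for b
    using p(3)[OF that] p(1) by simp
  have pS: "\<phi> (Suc i) (\<epsilon> (Suc i) b) = \<delta> (Suc i) (\<phi> (Suc (Suc i)) b)"
    if "b \<in> fmod V (m (Suc (Suc i)))" for i b
    using p(3)[OF that] by (simp add: aug_sub_def)
  let ?n = "cone_rank n m" and ?d = "cone_shift n d d' c" and ?D = "cone_bdry n \<delta> \<epsilon> \<phi>"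
  have D0: "?D 0 v = \<delta> 0 v" if "v \<in> fmod V (n (Suc 0))" for v
    by (simp add: cone_bdry_def cpart_id[OF that])
  have D1: "?D (Suc 0) (vjoin (n (Suc (Suc 0))) x y) = \<delta> (Suc 0) x + \<phi> (Suc 0) y"
    if "x \<in> fmod V (n (Suc (Suc 0)))" "y \<in> fmod V (m (Suc 0))" for x y
    using vjoin_0[OF fmod_closed(2)[OF ghomD(1)[OF dhom that(1)] ghomD(1)[OF p(2) that(2)]]]
    by (simp add: cone_bdry_def cpart_vjoin[OF that(1)] bpart_vjoin)
  have DS: "?D (Suc (Suc j)) (vjoin (n (Suc (Suc (Suc j)))) x y)
      = vjoin (n (Suc (Suc j))) (\<delta> (Suc (Suc j)) x + \<phi> (Suc (Suc j)) y) (- \<epsilon> (Suc j) y)"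
    if "x \<in> fmod V (n (Suc (Suc (Suc j))))" for j x y
    by (simp add: cone_bdry_def cpart_vjoin[OF that] bpart_vjoin)
  have split: "\<exists>x y. x \<in> fmod V (n (Suc (Suc j))) \<and> y \<in> fmod V (m (Suc j)) \<and> v = vjoin (n (Suc (Suc j))) x y"
    if "v \<in> fmod V (?n (Suc (Suc j)))" for v j
    using that vjoin_parts[of "n (Suc (Suc j))" v]
    by (intro exI[of _ "cpart (n (Suc (Suc j))) v"] exI[of _ "bpart (n (Suc (Suc j))) v"])
      (auto intro: cpart_fmod bpart_fmod)
  have augIK: "aug_sub V I 0 \<subseteq> aug_sub V K 0"
  proof -
    have "I \<subseteq> K"
      using hidealD(1)[OF I] ring_closed(1)[of V] by (force simp: K)
    then show ?thesis by (auto simp: aug_sub_def)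
  qed
  have "ghom V (?n (Suc i)) (?d (Suc i)) (?n i) (?d i) (?D i)" for i
  proof (cases i)
    case 0
    have "ghom V (n (Suc 0) + 0) (?d (Suc 0)) (n 0) (d 0) (?D 0)"
      unfolding cone_shift_simps
      by (rule ghom_cong[OF ghom_compose[OF ghom_cpart dhom[of 0]]]) (simp add: cone_bdry_def)
    then show ?thesis using 0 by simp
  next
    case (Suc j)
    have "ghom V (?n (Suc (Suc j))) (?d (Suc (Suc j))) (n (Suc j)) (d (Suc j))
        (\<lambda>v. \<delta> (Suc j) (cpart (n (Suc (Suc j))) v) + \<phi> (Suc j) (bpart (n (Suc (Suc j))) v))"
      using ghom_add[OF ghom_compose[OF ghom_cpart dhom] ghom_compose[OF ghom_bpart p(2)]] by simp
    moreover have "ghom V (?n (Suc (Suc j))) (?d (Suc (Suc j))) (if j = 0 then 0 else m j)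
        (\<lambda>k. d' j k + c) (\<lambda>v. if j = 0 then 0 else 0 - \<epsilon> j (bpart (n (Suc (Suc j))) v))"
      using ghom_minus[OF ghom_zero ghom_compose[OF ghom_bpart ehom]]
      by (cases "j = 0") (simp_all add: ghom_zero)
    ultimately have "ghom V (?n (Suc (Suc j))) (?d (Suc (Suc j)))
        (n (Suc j) + (if j = 0 then 0 else m j)) (dsum (n (Suc j)) (d (Suc j)) (\<lambda>k. d' j k + c))
        (\<lambda>v. vjoin (n (Suc j))
         (\<delta> (Suc j) (cpart (n (Suc (Suc j))) v) + \<phi> (Suc j) (bpart (n (Suc (Suc j))) v))
         (if j = 0 then 0 else 0 - \<epsilon> j (bpart (n (Suc (Suc j))) v)))"
      by (rule ghom_vjoin)
    moreover have "?D (Suc j) = (\<lambda>v. vjoin (n (Suc j))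
         (\<delta> (Suc j) (cpart (n (Suc (Suc j))) v) + \<phi> (Suc j) (bpart (n (Suc (Suc j))) v))
         (if j = 0 then 0 else 0 - \<epsilon> j (bpart (n (Suc (Suc j))) v)))"
      by (rule ext) (simp add: cone_bdry_def)
    ultimately show ?thesis using Suc by (simp only: cone_shift_simps) (simp add: cone_rank_def)
  qed
  moreover have "?D i (?D (Suc i) v) \<in> aug_sub V K i" if v: "v \<in> fmod V (?n (Suc (Suc i)))" for i v
  proof -
    obtain x y where xy: "x \<in> fmod V (n (Suc (Suc i)))" "y \<in> fmod V (m (Suc i))"
        "v = vjoin (n (Suc (Suc i))) x y"
      using split[OF v] by blast
    have x1: "\<delta> (Suc i) x \<in> fmod V (n (Suc i))" and y1: "\<phi> (Suc i) y \<in> fmod V (n (Suc i))"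
      and y2: "\<epsilon> i y \<in> fmod V (m i)"
      using ghomD(1)[OF dhom xy(1)] ghomD(1)[OF p(2) xy(2)] ghomD(1)[OF ehom xy(2)] .
    show ?thesis
    proof (cases i)
      case 0
      have z: "?D 0 (?D (Suc 0) v) = \<delta> 0 (\<delta> (Suc 0) x) + \<delta> 0 (\<phi> (Suc 0) y)"
        using xy x1 y1 0 by (simp add: D1 D0 fmod_closed ghomD(2)[OF dhom])
      \<comment> \<open>Both terms vanish modulo \<open>I\<close>; rearranged, the composite equals
        \<open>smul f (\<epsilon> 0 y)\<close> modulo \<open>I\<close>, which lies in
        \<open>K\<close> but in general not in \<open>I\<close>.\<close>
      have "\<delta> 0 (\<delta> (Suc 0) x) - (smul f (\<epsilon> 0 y) - \<delta> 0 (\<phi> (Suc 0) y)) \<in> aug_sub V I 0"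
        using xy 0 by (intro gsubmod_diff[OF B] gcomplexD(3)[OF g(1)] p0) auto
      then have *: "?D 0 (?D (Suc 0) v) - smul f (\<epsilon> 0 y) \<in> aug_sub V I 0"
        unfolding z by (simp add: algebra_simps)
      have e: "\<epsilon> 0 y 0 \<in> carrier (poly_ring V)"
        using y2 0 by (simp add: fmod_def)
      have fe: "smul f (\<epsilon> 0 y) \<in> fmod V 1"
        using fmod_closed(5)[OF f(1) y2] 0 m0 by simp
      have "?D 0 (?D (Suc 0) v) - smul f (\<epsilon> 0 y) + smul f (\<epsilon> 0 y) \<in> fmod V 1"
        using * fe by (intro fmod_closed(2)) (simp_all add: aug_sub_def)
      then have DD: "?D 0 (?D (Suc 0) v) \<in> fmod V 1" by simp
      then have "?D 0 (?D (Suc 0) v) 0 \<in> K"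
        using * e by (auto simp: K aug_sub_def fmod_def)
      then show ?thesis using DD 0 by (simp add: aug_sub_def)
    next
      case (Suc j)
      have "?D (Suc i) v = vjoin (n (Suc i)) (\<delta> (Suc i) x + \<phi> (Suc i) y) (- \<epsilon> i y)"
        using DS[of x j y] xy Suc by simp
      moreover have "\<delta> (Suc j) (\<delta> (Suc i) x + \<phi> (Suc i) y) + \<phi> (Suc j) (- \<epsilon> i y) = 0"
        using gcomplexD(3)[OF g(1), of x "Suc j"] pS[of y j] xy x1 y1 y2 Suc
        by (simp add: ghomD(2)[OF dhom] ghom_uminus[OF p(2)] aug_sub_def)
      moreover have "\<epsilon> j (- \<epsilon> i y) = 0" if "j \<noteq> 0"
      proof -
        obtain l where "j = Suc l" using \<open>j \<noteq> 0\<close> by (cases j) auto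
        then show ?thesis
          using gcomplexD(3)[OF h', of y j] xy y2 Suc by (simp add: ghom_uminus[OF ehom] aug_sub_def)
      qed
      moreover have s: "\<delta> (Suc i) x + \<phi> (Suc i) y \<in> fmod V (n (Suc (Suc j)))"
        using x1 y1 Suc by (simp add: fmod_closed)
      ultimately have "?D (Suc j) (?D (Suc i) v) = vjoin (n (Suc j)) 0 0"
        using Suc by (simp add: cone_bdry_def[of _ _ _ _ "Suc j"] cpart_vjoin[OF s[unfolded Suc]] bpart_vjoin)
      then show ?thesis
        using Suc vjoin_0[OF fmod_closed(1)] by (simp add: aug_sub_def)
    qed
  qed
  ultimately have cx: "gcomplex V K ?n ?d ?D"
    using n0 by (simp add: gcomplex_def)
  have "gexact V K ?n ?D"
    unfolding gexact_def
  proof (intro allI ballI)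
    fix i v assume cyc: "v \<in> cycles V K ?n ?D i"
    then have v: "v \<in> fmod V (?n i)" "\<And>j. i = Suc j \<Longrightarrow> ?D j v \<in> aug_sub V K j"
      unfolding cycles_def by blast+
    consider "i = 0" | "i = Suc 0" | j where "i = Suc (Suc j)"
      by (metis nat.exhaust)
    then show "\<exists>w \<in> fmod V (?n (Suc i)). v - ?D i w \<in> aug_sub V K i"
    proof cases
      case 1
      then have "v \<in> cycles V I n \<delta> 0" using v(1) by (simp add: cycles_def)
      then obtain w where "w \<in> fmod V (n (Suc 0))" "v - \<delta> 0 w \<in> aug_sub V I 0"
        using g(2) unfolding gexact_def by blast
      then show ?thesis using 1 D0 augIK by auto
    next
      case 2
      then have v1: "v \<in> fmod V (n (Suc 0))" "\<delta> 0 v \<in> aug_sub V K 0"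
        using v D0[of v] by auto
      \<comment> \<open>A cycle modulo \<open>K\<close> is a cycle modulo \<open>I\<close> up to
        \<open>f * q\<close>. Writing \<open>q\<close> as \<open>\<epsilon> 0 b\<close> modulo
        \<open>J\<close> makes the error fall into \<open>I\<close> after multiplication by
        \<open>f\<close>, so \<open>v - \<phi> (Suc 0) b\<close> is a cycle of the first
        complex.\<close>
      then obtain q where q: "q \<in> carrier (poly_ring V)" "\<delta> 0 v 0 - f * q \<in> I"
        by (auto simp: aug_sub_def K)
      have "scalarv q \<in> cycles V J m \<epsilon> 0"
        using scalarv_fmod[OF q(1)] m0 by (simp add: cycles_def)
      then obtain b where b: "b \<in> fmod V (m (Suc 0))" "scalarv q - \<epsilon> 0 b \<in> aug_sub V J 0"
        using h(2) unfolding gexact_def by blast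
      have "smul f (scalarv q - \<epsilon> 0 b) \<in> aug_sub V I 0"
        using smJ[of "scalarv q - \<epsilon> 0 b"] b(2) by (simp add: aug_sub_def)
      moreover have "\<delta> 0 v - smul f (scalarv q) \<in> aug_sub V I 0"
        using v1(2) fmod_closed(5)[OF f(1) scalarv_fmod[OF q(1)]] q(2)
        by (simp add: aug_sub_def fmod_closed)
      ultimately have "(\<delta> 0 v - smul f (scalarv q)) + smul f (scalarv q - \<epsilon> 0 b)
          + (smul f (\<epsilon> 0 b) - \<delta> 0 (\<phi> (Suc 0) b)) \<in> aug_sub V I 0"
        by (intro gsubmodD(3)[OF B] p0 b(1))
      moreover have "(\<delta> 0 v - smul f (scalarv q)) + smul f (scalarv q - \<epsilon> 0 b)
          + (smul f (\<epsilon> 0 b) - \<delta> 0 (\<phi> (Suc 0) b)) = \<delta> 0 v - \<delta> 0 (\<phi> (Suc 0) b)"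
        by (simp add: fun_eq_iff algebra_simps)
      moreover have pb: "\<phi> (Suc 0) b \<in> fmod V (n (Suc 0))"
        by (rule ghomD(1)[OF p(2) b(1)])
      ultimately have "v - \<phi> (Suc 0) b \<in> cycles V I n \<delta> (Suc 0)"
        using v1(1) by (simp add: cycles_def fmod_closed ghom_diff[OF dhom])
      then obtain w where w: "w \<in> fmod V (n (Suc (Suc 0)))"
          "v - \<phi> (Suc 0) b - \<delta> (Suc 0) w \<in> aug_sub V I (Suc 0)"
        using g(2) unfolding gexact_def by blast
      then have "v = \<delta> (Suc 0) w + \<phi> (Suc 0) b"
        by (simp add: aug_sub_def algebra_simps)
      then have "v - ?D (Suc 0) (vjoin (n (Suc (Suc 0))) w b) = 0"
        by (simp add: D1[OF w(1) b(1)])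
      moreover have "vjoin (n (Suc (Suc 0))) w b \<in> fmod V (?n (Suc (Suc 0)))"
        using vjoin_fmod[OF w(1) b(1)] by simp
      ultimately show ?thesis
        unfolding 2 by (intro bexI[of _ "vjoin (n (Suc (Suc 0))) w b"]) (simp_all add: aug_sub_def)
    next
      case (3 j)
      obtain x y where xy: "x \<in> fmod V (n (Suc (Suc j)))" "y \<in> fmod V (m (Suc j))"
          "v = vjoin (n (Suc (Suc j))) x y"
        using split v(1) unfolding 3 by blast
      have x1: "\<delta> (Suc j) x \<in> fmod V (n (Suc j))" and y1: "\<phi> (Suc j) y \<in> fmod V (n (Suc j))"
        using ghomD(1)[OF dhom xy(1)] ghomD(1)[OF p(2) xy(2)] .
      have "?D (Suc j) v = 0"
        using v(2)[OF 3] by (simp add: aug_sub_def)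
      then have "vjoin (n (Suc j)) (\<delta> (Suc j) x + \<phi> (Suc j) y) (if j = 0 then 0 else 0 - \<epsilon> j y) = 0"
        by (simp only: cone_bdry_def xy(3) cpart_vjoin[OF xy(1)] bpart_vjoin nat.case)
      note z0 = vjoin_eq_0[OF fmod_closed(2)[OF x1 y1] this]
      have xy0: "\<delta> (Suc j) x + \<phi> (Suc j) y = 0"
        by (rule z0(1))
      have y0: "\<epsilon> j y = 0" if "j \<noteq> 0"
        using z0(2) that by simp
      have "\<epsilon> j y \<in> aug_sub V J j"
      proof (cases j)
        case 0
        \<comment> \<open>For \<open>j = 0\<close> the second component gives no equation, so
          \<open>\<epsilon> 0 y\<close> must be placed in \<open>J\<close> by the first one: it puts
          \<open>f\<close> times this element into \<open>I\<close>, and injectivity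
          applies.\<close>
        have "\<delta> 0 (\<phi> (Suc 0) y) = - \<delta> 0 (\<delta> (Suc 0) x)"
          using xy0 x1 0 ghom_uminus[OF dhom] by (metis eq_neg_iff_add_eq_0 add.commute)
        then have "\<delta> 0 (\<phi> (Suc 0) y) \<in> aug_sub V I 0"
          using gcomplexD(3)[OF g(1), of x 0] xy(1) 0 by (simp add: gsubmod_uminus[OF B])
        then have "(smul f (\<epsilon> 0 y) - \<delta> 0 (\<phi> (Suc 0) y)) + \<delta> 0 (\<phi> (Suc 0) y) \<in> aug_sub V I 0"
          using p0[of y] xy(2) 0 by (intro gsubmodD(3)[OF B]) auto
        then have "smul f (\<epsilon> 0 y) \<in> aug_sub V I 0" by simp
        then show ?thesis
          using smJ[of "\<epsilon> 0 y"] ghomD(1)[OF ehom, of y 0] xy(2) 0 m0 by simp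
      next
        case (Suc l)
        then show ?thesis using y0 by (simp add: aug_sub_def)
      qed
      then have "y \<in> cycles V J m \<epsilon> (Suc j)"
        using xy(2) by (simp add: cycles_def)
      then obtain b where b: "b \<in> fmod V (m (Suc (Suc j)))" "y - \<epsilon> (Suc j) b \<in> aug_sub V J (Suc j)"
        using h(2) unfolding gexact_def by blast
      then have yb: "y = \<epsilon> (Suc j) b"
        by (simp add: aug_sub_def)
      have b1: "\<phi> (Suc (Suc j)) b \<in> fmod V (n (Suc (Suc j)))"
        by (rule ghomD(1)[OF p(2) b(1)])
      have "\<delta> (Suc j) (x + \<phi> (Suc (Suc j)) b) = 0"
        using xy0 by (simp add: ghomD(2)[OF dhom xy(1) b1] pS[OF b(1), symmetric] yb)
      then have "x + \<phi> (Suc (Suc j)) b \<in> cycles V I n \<delta> (Suc (Suc j))"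
        using xy(1) b1 gsubmodD(2)[OF B] by (simp add: cycles_def fmod_closed)
      then obtain w where w: "w \<in> fmod V (n (Suc (Suc (Suc j))))"
          "x + \<phi> (Suc (Suc j)) b - \<delta> (Suc (Suc j)) w \<in> aug_sub V I (Suc (Suc j))"
        using g(2) unfolding gexact_def by blast
      \<comment> \<open>The preimage has second component \<open>- b\<close>, to cancel the sign in
        the cone differential.\<close>
      have "x = \<delta> (Suc (Suc j)) w + \<phi> (Suc (Suc j)) (- b)"
        using w(2) by (simp add: aug_sub_def ghom_uminus[OF p(2) b(1)] algebra_simps)
      then have "v = ?D (Suc (Suc j)) (vjoin (n (Suc (Suc (Suc j)))) w (- b))"
        using yb ghom_uminus[OF ehom b(1)] by (simp add: DS[OF w(1)] xy(3))
      moreover have "vjoin (n (Suc (Suc (Suc j)))) w (- b) \<in> fmod V (?n (Suc (Suc (Suc j))))"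
        using vjoin_fmod[OF w(1) fmod_closed(4)[OF b(1)]] by simp
      ultimately show ?thesis
        unfolding 3 by (intro bexI[of _ "vjoin (n (Suc (Suc (Suc j)))) w (- b)"])
          (simp_all add: aug_sub_def)
    qed
  qed
  with cx g(3) have "gres V K ?n ?d ?D"
    by (simp add: gres_def)
  then show thesis by (rule that)
qed


section \<open>Square-free monomial ideals\<close>

definition sqf :: "'v set \<Rightarrow> 'v \<Rightarrow>\<^sub>0 nat" where
  "sqf A = (\<Sum>x\<in>A. Poly_Mapping.single x 1)"

lemma lookup_sqf: "finite A \<Longrightarrow> Poly_Mapping.lookup (sqf A) x = (if x \<in> A then 1 else 0)"
proof -
  assume A: "finite A"
  have "Poly_Mapping.lookup (sqf A) x = (\<Sum>y\<in>A. if x = y then 1 else 0)"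
    unfolding sqf_def lookup_sum by (intro sum.cong) (auto simp: lookup_single when_def)
  then show ?thesis using A by simp
qed

lemma keys_sqf: "finite A \<Longrightarrow> Poly_Mapping.keys (sqf A) = A"
  by (auto simp: in_keys_iff lookup_sqf split: if_splits)

lemma mon_degree_sqf: "finite A \<Longrightarrow> mon_degree (sqf A) = card A"
  by (simp add: mon_degree_def keys_sqf lookup_sqf)

lemma prod_var: "finite A \<Longrightarrow> (\<Prod>x\<in>A. var x) = Poly_Mapping.single (sqf A) 1"
  by (induction A rule: finite_induct) (simp_all add: sqf_def var_def mult_single)

lemma keys_nat_add: "Poly_Mapping.keys (a + b) = Poly_Mapping.keys a \<union> Poly_Mapping.keys (b :: 'v \<Rightarrow>\<^sub>0 nat)"
  by (auto simp: in_keys_iff lookup_add)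

text \<open>All exponents of \<open>sqf A\<close> are at most 1, so divisibility reduces to
  containment of supports.\<close>

lemma sqf_divides:
  assumes "finite A" "A \<subseteq> Poly_Mapping.keys m"
  shows "\<exists>u. m = sqf A + u"
proof
  show "m = sqf A + (m - sqf A)"
  proof (rule poly_mapping_eqI)
    fix x
    have "Poly_Mapping.lookup (sqf A) x \<le> Poly_Mapping.lookup m x"
      using assms by (auto simp: lookup_sqf in_keys_iff Suc_le_eq)
    then show "Poly_Mapping.lookup m x = Poly_Mapping.lookup (sqf A + (m - sqf A)) x"
      by (simp add: lookup_add lookup_minus)
  qed
qed

lemma sum_monomials:
  "(\<Sum>m\<in>Poly_Mapping.keys p. Poly_Mapping.single m (Poly_Mapping.lookup p m)) = p"
proof (rule poly_mapping_eqI)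
  fix k
  have "Poly_Mapping.lookup (\<Sum>m\<in>Poly_Mapping.keys p. Poly_Mapping.single m (Poly_Mapping.lookup p m)) k
      = (\<Sum>m\<in>Poly_Mapping.keys p. if k = m then Poly_Mapping.lookup p k else 0)"
    unfolding lookup_sum by (intro sum.cong) (auto simp: lookup_single when_def)
  also have "\<dots> = Poly_Mapping.lookup p k"
    by (simp add: in_keys_iff)
  finally show "Poly_Mapping.lookup
      (\<Sum>m\<in>Poly_Mapping.keys p. Poly_Mapping.single m (Poly_Mapping.lookup p m)) k = Poly_Mapping.lookup p k" .
qed

lemma mem_of_monomials:
  fixes p :: "'a \<Rightarrow>\<^sub>0 'b::comm_monoid_add"
  assumes "0 \<in> S" "\<And>x y. x \<in> S \<Longrightarrow> y \<in> S \<Longrightarrow> x + y \<in> S"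
    and "\<And>m. m \<in> Poly_Mapping.keys p \<Longrightarrow> Poly_Mapping.single m (Poly_Mapping.lookup p m) \<in> S"
  shows "p \<in> S"
proof -
  have "(\<Sum>m\<in>K. Poly_Mapping.single m (Poly_Mapping.lookup p m)) \<in> S"
    if "K \<subseteq> Poly_Mapping.keys p" for K
    using that
  proof (induction K rule: infinite_finite_induct)
    case (insert m K)
    then show ?case using assms(2)[OF assms(3)[of m]] by simp
  qed (simp_all add: assms(1))
  from this[OF order_refl] show ?thesis
    by (simp only: sum_monomials)
qed

lemma single_closed:
  "Poly_Mapping.keys m \<subseteq> V \<Longrightarrow> Poly_Mapping.single m a \<in> carrier (poly_ring V)"
  by (simp add: poly_ring_def)

lemma homogeneous_single: "homogeneous (int (mon_degree m)) (Poly_Mapping.single m a)"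
  by (simp add: homogeneous_def)

text \<open>Translation of exponents by \<open>s\<close> is injective, so nothing cancels and the
  inclusion \<open>keys_mult\<close> becomes an equality.\<close>

lemma keys_single_mult:
  fixes p :: "('v, 'k::field) mpoly"
  shows "Poly_Mapping.keys (Poly_Mapping.single s 1 * p) = (+) s ` Poly_Mapping.keys p"
proof -
  have "Poly_Mapping.single s 1 * p =
      (\<Sum>m\<in>Poly_Mapping.keys p. Poly_Mapping.single (s + m) (Poly_Mapping.lookup p m))"
    by (subst (1) sum_monomials[of p, symmetric]) (simp add: sum_distrib_left mult_single)
  then have *: "Poly_Mapping.lookup (Poly_Mapping.single s 1 * p) k =
      (\<Sum>m\<in>Poly_Mapping.keys p. if k = s + m then Poly_Mapping.lookup p m else 0)" for k
    by (simp add: lookup_sum lookup_single when_def eq_commute)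
  have "Poly_Mapping.lookup (Poly_Mapping.single s 1 * p) (s + u) = Poly_Mapping.lookup p u" for u
  proof -
    have "Poly_Mapping.lookup (Poly_Mapping.single s 1 * p) (s + u) =
        (\<Sum>m\<in>Poly_Mapping.keys p. if u = m then Poly_Mapping.lookup p u else 0)"
      unfolding * by (intro sum.cong) auto
    then show ?thesis by (simp add: in_keys_iff)
  qed
  then have "s + u \<in> Poly_Mapping.keys (Poly_Mapping.single s 1 * p)"
    if "u \<in> Poly_Mapping.keys p" for u
    using that by (simp add: in_keys_iff)
  then show ?thesis
    using Poly_Mapping.keys_mult[of "Poly_Mapping.single s 1" p] by auto
qed

text \<open>
  A monomial lies in a square-free monomial ideal iff its support contains that of a generator.
\<close>

definition sqf_ideal :: "'v set \<Rightarrow> 'v set set \<Rightarrow> ('v, 'k::field) mpoly set" where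
  "sqf_ideal V \<B> = {p \<in> carrier (poly_ring V).
     \<forall>m \<in> Poly_Mapping.keys p. \<exists>A\<in>\<B>. A \<subseteq> Poly_Mapping.keys m}"

lemma sqf_ideal_hideal: "hideal V (sqf_ideal V \<B>)"
proof -
  have "p + q \<in> sqf_ideal V \<B>" if "p \<in> sqf_ideal V \<B>" "q \<in> sqf_ideal V \<B>" for p q
    unfolding sqf_ideal_def
  proof (intro CollectI conjI ballI)
    show "p + q \<in> carrier (poly_ring V)"
      using that by (simp add: sqf_ideal_def ring_closed)
    fix m assume "m \<in> Poly_Mapping.keys (p + q)"
    then have "m \<in> Poly_Mapping.keys p \<or> m \<in> Poly_Mapping.keys q"
      using Poly_Mapping.keys_add[of p q] by blast
    then show "\<exists>A\<in>\<B>. A \<subseteq> Poly_Mapping.keys m"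
      using that unfolding sqf_ideal_def by blast
  qed
  moreover have "a * p \<in> sqf_ideal V \<B>"
    if "a \<in> carrier (poly_ring V)" "p \<in> sqf_ideal V \<B>" for a p
  proof -
    have "\<exists>A\<in>\<B>. A \<subseteq> Poly_Mapping.keys m" if m: "m \<in> Poly_Mapping.keys (a * p)" for m
    proof -
      obtain u w where u: "m = u + w" "w \<in> Poly_Mapping.keys p"
        using m Poly_Mapping.keys_mult[of a p] by blast
      then obtain A where "A \<in> \<B>" "A \<subseteq> Poly_Mapping.keys w"
        using \<open>p \<in> _\<close> unfolding sqf_ideal_def by blast
      then show ?thesis
        unfolding u(1) keys_nat_add by blast
    qed
    then show ?thesis using that by (simp add: sqf_ideal_def ring_closed)
  qed
  moreover have "hpart e p \<in> sqf_ideal V \<B>" if "p \<in> sqf_ideal V \<B>" for e p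
    using that by (simp add: sqf_ideal_def hpart_closed keys_hpart)
  moreover have "sqf_ideal V \<B> \<subseteq> carrier (poly_ring V)" "0 \<in> sqf_ideal V \<B>"
    by (auto simp: sqf_ideal_def ring_closed)
  ultimately show ?thesis
    unfolding hideal_def by blast
qed

text \<open>The description by supports can be checked term by term: a monomial whose support
  contains \<open>A\<close> is a multiple of the generator of \<open>A\<close>.\<close>

lemma sqf_ideal_eq_genideal:
  assumes V: "finite V" "\<And>A. A \<in> \<B> \<Longrightarrow> A \<subseteq> V"
  shows "Idl\<^bsub>poly_ring V\<^esub> ((\<lambda>A. Poly_Mapping.single (sqf A) 1) ` \<B>)
    = (sqf_ideal V \<B> :: ('v, 'k::field) mpoly set)"
proof -
  interpret R: cring "poly_ring V :: ('v, 'k) mpoly ring" by (rule cring_poly_ring)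
  let ?S = "(\<lambda>A. Poly_Mapping.single (sqf A) 1) ` \<B> :: ('v, 'k) mpoly set"
  have fin: "finite A" if "A \<in> \<B>" for A
    using V that finite_subset by blast
  have S: "?S \<subseteq> carrier (poly_ring V)"
  proof (rule image_subsetI, rule single_closed)
    show "Poly_Mapping.keys (sqf A) \<subseteq> V" if "A \<in> \<B>" for A
      using V(2)[OF that] by (simp only: keys_sqf[OF fin[OF that]])
  qed
  interpret J: ideal "Idl\<^bsub>poly_ring V\<^esub> ?S" "poly_ring V"
    by (rule R.genideal_ideal[OF S])
  show ?thesis
  proof
    have "?S \<subseteq> sqf_ideal V \<B>"
    proof
      fix p assume p: "p \<in> ?S"
      then obtain A where A: "A \<in> \<B>" "p = Poly_Mapping.single (sqf A) 1" by blast
      have "p \<in> carrier (poly_ring V)" using p S by blast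
      moreover have "Poly_Mapping.keys p = {sqf A}" by (simp add: A(2))
      moreover have "Poly_Mapping.keys (sqf A) = A" by (rule keys_sqf[OF fin[OF A(1)]])
      ultimately show "p \<in> sqf_ideal V \<B>"
        using A(1) by (auto simp: sqf_ideal_def)
    qed
    then show "Idl\<^bsub>poly_ring V\<^esub> ?S \<subseteq> sqf_ideal V \<B>"
      by (rule R.genideal_minimal[OF hideal_ideal[OF sqf_ideal_hideal]])
    show "sqf_ideal V \<B> \<subseteq> Idl\<^bsub>poly_ring V\<^esub> ?S"
    proof
      fix p :: "('v, 'k) mpoly" assume p: "p \<in> sqf_ideal V \<B>"
      have "Poly_Mapping.single m (Poly_Mapping.lookup p m) \<in> Idl\<^bsub>poly_ring V\<^esub> ?S"
        if m: "m \<in> Poly_Mapping.keys p" for m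
      proof -
        obtain A where A: "A \<in> \<B>" "A \<subseteq> Poly_Mapping.keys m"
          using p m by (auto simp: sqf_ideal_def)
        then obtain u where u: "m = sqf A + u"
          using sqf_divides[OF fin] by blast
        have "Poly_Mapping.keys m \<subseteq> V"
          using p m by (auto simp: sqf_ideal_def poly_ring_def)
        then have "Poly_Mapping.single u (Poly_Mapping.lookup p m) \<in> carrier (poly_ring V)"
          by (intro single_closed) (auto simp: u keys_nat_add)
        moreover have "Poly_Mapping.single (sqf A) 1 \<in> Idl\<^bsub>poly_ring V\<^esub> ?S"
          using R.genideal_self[OF S] A(1) by blast
        ultimately have "Poly_Mapping.single u (Poly_Mapping.lookup p m) * Poly_Mapping.single (sqf A) 1
            \<in> Idl\<^bsub>poly_ring V\<^esub> ?S"
          using J.I_l_closed by (simp add: poly_ring_simps)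
        then show ?thesis by (simp add: mult_single u add.commute)
      qed
      then show "p \<in> Idl\<^bsub>poly_ring V\<^esub> ?S"
        using J.zero_closed J.a_closed unfolding poly_ring_simps
        by (rule mem_of_monomials[rotated 2])
    qed
  qed
qed

text \<open>The variables are the square-free monomials of the singletons, and a monomial is
  divisible by a variable iff it is not 1.\<close>

lemma irrelevant_ideal_eq:
  fixes V :: "'v set"
  assumes "finite V"
  shows "irrelevant_ideal V =
    {p \<in> carrier (poly_ring V) :: ('v, 'k::field) mpoly set. Poly_Mapping.lookup p 0 = 0}"
proof -
  have "(var ` V :: ('v, 'k) mpoly set) = (\<lambda>A. Poly_Mapping.single (sqf A) 1) ` (\<lambda>x. {x}) ` V"
    by (auto simp: var_def sqf_def image_iff)
  then have "(irrelevant_ideal V :: ('v, 'k) mpoly set) = sqf_ideal V ((\<lambda>x. {x}) ` V)"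
    unfolding irrelevant_ideal_def using assms by (simp only:) (rule sqf_ideal_eq_genideal, auto)
  also have "\<dots> = {p \<in> carrier (poly_ring V). Poly_Mapping.lookup p 0 = 0}"
  proof -
    have "(\<exists>x\<in>V. x \<in> Poly_Mapping.keys m) \<longleftrightarrow> m \<noteq> 0" if "Poly_Mapping.keys m \<subseteq> V" for m :: "'v \<Rightarrow>\<^sub>0 nat"
      using that by (auto simp flip: keys_eq_empty)
    then have "(\<forall>m \<in> Poly_Mapping.keys p. \<exists>x\<in>V. x \<in> Poly_Mapping.keys m) \<longleftrightarrow> 0 \<notin> Poly_Mapping.keys p"
      if "p \<in> carrier (poly_ring V)" for p :: "('v, 'k) mpoly"
      using that by (auto simp: poly_ring_def)
    then show ?thesis
      by (auto simp: sqf_ideal_def in_keys_iff)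
  qed
  finally show ?thesis .
qed

text \<open>Multiplication by the monomial of \<open>B\<close> adds \<open>B\<close> to each
  support, and \<open>A \<subseteq> B \<union> U\<close> iff \<open>A - B \<subseteq> U\<close>.
  This is the hypothesis \<open>colon\<close> of \<open>gres_cone\<close>.\<close>

lemma sqf_ideal_colon:
  assumes "finite B" "p \<in> carrier (poly_ring V)" "B \<subseteq> V"
  shows "p \<in> sqf_ideal V ((\<lambda>A. A - B) ` \<B>) \<longleftrightarrow> Poly_Mapping.single (sqf B) 1 * p \<in> sqf_ideal V \<B>"
proof -
  have "Poly_Mapping.single (sqf B) 1 * p \<in> carrier (poly_ring V)"
    using assms by (intro ring_closed single_closed) (simp_all add: keys_sqf)
  moreover have "A - B \<subseteq> U \<longleftrightarrow> A \<subseteq> B \<union> U" for A U by blast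
  ultimately show ?thesis
    using assms(2) by (simp add: sqf_ideal_def keys_single_mult keys_nat_add keys_sqf[OF assms(1)])
qed

text \<open>Supplies the hypothesis \<open>K\<close> of \<open>gres_cone\<close>. Each term is
  either a multiple of the new generator or already in the old ideal, and the right-hand side is
  closed under addition.\<close>

lemma sqf_ideal_insert:
  fixes V :: "'v set" and \<B> :: "'v set set"
  assumes B: "finite B" "B \<subseteq> V"
  shows "(sqf_ideal V (insert B \<B>) :: ('v, 'k::field) mpoly set) = {p \<in> carrier (poly_ring V).
    \<exists>q \<in> carrier (poly_ring V). p - Poly_Mapping.single (sqf B) 1 * q \<in> sqf_ideal V \<B>}"
    (is "?L = ?R")
proof
  let ?b = "Poly_Mapping.single (sqf B) 1 :: ('v, 'k) mpoly"
  have b: "?b \<in> carrier (poly_ring V)"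
    using B by (intro single_closed) (simp add: keys_sqf)
  note h = sqf_ideal_hideal[of V]
  show "?R \<subseteq> ?L"
  proof
    fix p assume "p \<in> ?R"
    then obtain q where q: "q \<in> carrier (poly_ring V)" "p - ?b * q \<in> sqf_ideal V \<B>" by blast
    then have "p - ?b * q \<in> ?L" by (auto simp: sqf_ideal_def)
    moreover have "?b * q \<in> ?L"
      using q(1) b by (auto simp: sqf_ideal_def ring_closed keys_single_mult keys_nat_add keys_sqf[OF B(1)])
    ultimately have "(p - ?b * q) + ?b * q \<in> ?L"
      by (rule hidealD(3)[OF h])
    then show "p \<in> ?L" by simp
  qed
  show "?L \<subseteq> ?R"
  proof
    fix p :: "('v, 'k) mpoly" assume p: "p \<in> ?L"
    have "Poly_Mapping.single m (Poly_Mapping.lookup p m) \<in> ?R" if m: "m \<in> Poly_Mapping.keys p" for m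
    proof -
      have mV: "Poly_Mapping.keys m \<subseteq> V"
        using p m by (auto simp: sqf_ideal_def poly_ring_def)
      note c = single_closed[OF mV, of "Poly_Mapping.lookup p m"]
      consider "B \<subseteq> Poly_Mapping.keys m" | A where "A \<in> \<B>" "A \<subseteq> Poly_Mapping.keys m"
        using p m by (auto simp: sqf_ideal_def)
      then show ?thesis
      proof cases
        case 1
        then obtain u where u: "m = sqf B + u"
          using sqf_divides[OF B(1)] by blast
        then have "Poly_Mapping.single u (Poly_Mapping.lookup p m) \<in> carrier (poly_ring V)"
          using mV by (intro single_closed) (auto simp: keys_nat_add)
        moreover have "Poly_Mapping.single m (Poly_Mapping.lookup p m)
            - ?b * Poly_Mapping.single u (Poly_Mapping.lookup p m) = 0"
          by (simp add: mult_single u)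
        ultimately show ?thesis
          using c hidealD(2)[OF h] by force
      next
        case 2
        then have "Poly_Mapping.single m (Poly_Mapping.lookup p m) - ?b * 0 \<in> sqf_ideal V \<B>"
          using c by (auto simp: sqf_ideal_def)
        then show ?thesis using c ring_closed(1) by blast
      qed
    qed
    moreover have "0 \<in> ?R"
      using hidealD(2)[OF h] ring_closed(1) by force
    moreover have "x + y \<in> ?R" if xy: "x \<in> ?R" "y \<in> ?R" for x y
    proof -
      obtain q q' where q: "q \<in> carrier (poly_ring V)" "x - ?b * q \<in> sqf_ideal V \<B>"
          "q' \<in> carrier (poly_ring V)" "y - ?b * q' \<in> sqf_ideal V \<B>"
        using xy by blast
      have "(x - ?b * q) + (y - ?b * q') = x + y - ?b * (q + q')"
        by (simp add: distrib_left)
      then have "x + y - ?b * (q + q') \<in> sqf_ideal V \<B>"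
        using hidealD(3)[OF h q(2,4)] by (simp only:)
      then show ?thesis
        using xy q ring_closed(4) by blast
    qed
    ultimately show "p \<in> ?R"
      by (rule mem_of_monomials[of ?R, rotated 2])
  qed
qed


section \<open>Linear resolutions\<close>

text \<open>
  Position \<open>i + 2\<close> is \<open>F\<^bsub>i+1\<^esub>\<close>, so \<open>N\<close> is the number of generators of \<open>I\<close>, all of degree \<open>c\<close>.
\<close>

definition linear_res :: "'v set \<Rightarrow> ('v, 'k::field) mpoly set \<Rightarrow> nat \<Rightarrow> nat \<Rightarrow> bool" where
  "linear_res V I c N \<longleftrightarrow> (\<exists>n d \<delta>. gres V I n d \<delta> \<and> n (Suc 0) = 1 \<and> d (Suc 0) 0 = 0
     \<and> n (Suc (Suc 0)) = N \<and> (\<forall>i. \<forall>k < n (Suc (Suc i)). d (Suc (Suc i)) k = int (i + c)))"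

lemma fmod_0: "v \<in> fmod V 0 \<longleftrightarrow> v = 0"
  by (auto simp: fmod_def fun_eq_iff ring_closed)

text \<open>R resolves itself, by the identity from position 1 to position 0. No generator fixes a
  degree, so \<open>c\<close> is free; this starts the inductions for variables and for
  bases.\<close>

lemma linear_res_zero: "linear_res V (sqf_ideal V {}) c 0"
proof -
  define n :: "nat \<Rightarrow> nat" where "n = (\<lambda>i. if i \<le> 1 then 1 else 0)"
  define \<delta> :: "nat \<Rightarrow> ('a, 'b) pvec \<Rightarrow> ('a, 'b) pvec" where
    "\<delta> = (\<lambda>i. if i = 0 then (\<lambda>v. v) else (\<lambda>_. 0))"
  have I: "(sqf_ideal V {} :: ('a, 'b) mpoly set) = {0}"
    by (auto simp: sqf_ideal_def ring_closed)
  have aug: "aug_sub V {0} i = ({0} :: ('a, 'b) pvec set)" for i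
  proof -
    have "v = 0" if "v \<in> fmod V 1" "v 0 = 0" for v :: "('a, 'b) pvec"
      using fmod_1_eq[OF that(1)] that(2) by (simp add: scalarv_def fun_eq_iff)
    then show ?thesis
      unfolding aug_sub_def using fmod_closed(1)[of V 1] by auto
  qed
  have "gcomplex V {0} n (\<lambda>_ _. 0) \<delta>"
    unfolding gcomplex_def aug by (auto simp: n_def \<delta>_def ghom_zero ghom_id)
  moreover have "gexact V {0} n \<delta>"
    unfolding gexact_def
  proof (intro allI ballI)
    fix i and v :: "('a, 'b) pvec" assume v: "v \<in> cycles V {0} n \<delta> i"
    consider "i = 0" | "i = 1" | "i \<ge> 2" by linarith
    then show "\<exists>w\<in>fmod V (n (Suc i)). v - \<delta> i w \<in> aug_sub V {0} i"
    proof cases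
      case 1
      then show ?thesis using v unfolding aug by (auto simp: cycles_def n_def \<delta>_def)
    next
      case 2
      then have "v = 0" using v unfolding aug cycles_def by (auto simp: \<delta>_def)
      then show ?thesis using 2 unfolding aug by (auto simp: \<delta>_def intro!: exI[of _ 0] fmod_closed)
    next
      case 3
      then have "v = 0" using v by (auto simp: cycles_def n_def fmod_0)
      then show ?thesis using 3 unfolding aug by (auto simp: \<delta>_def intro!: exI[of _ 0] fmod_closed)
    qed
  qed
  ultimately have "gres V {0} n (\<lambda>_ _. 0) \<delta>"
    by (simp add: gres_def)
  then show ?thesis
    unfolding linear_res_def I by (intro exI[of _ n] exI[of _ "\<lambda>_ _. 0"] exI[of _ \<delta>]) (simp add: n_def)
qed

text \<open>The rank one module R at position 1 of the second complex, shifted by \<open>c\<close>,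
  becomes the new generator at position 2 of the cone; hence \<open>Suc N\<close>.\<close>

lemma linear_res_insert:
  fixes V :: "'v set"
  assumes B: "finite B" "B \<subseteq> V" "card B = c"
    and L: "linear_res V (sqf_ideal V \<B> :: ('v, 'k::field) mpoly set) c N"
    and M: "linear_res V (sqf_ideal V ((\<lambda>A. A - B) ` \<B>) :: ('v, 'k) mpoly set) 1 M"
  shows "linear_res V (sqf_ideal V (insert B \<B>) :: ('v, 'k) mpoly set) c (Suc N)"
proof -
  obtain n d \<delta> where G: "gres V (sqf_ideal V \<B> :: ('v, 'k) mpoly set) n d \<delta>"
    and g: "n (Suc 0) = 1" "d (Suc 0) 0 = 0" "n (Suc (Suc 0)) = N"
      "\<And>i k. k < n (Suc (Suc i)) \<Longrightarrow> d (Suc (Suc i)) k = int (i + c)"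
    using L unfolding linear_res_def by blast
  obtain m d' \<epsilon> where H: "gres V (sqf_ideal V ((\<lambda>A. A - B) ` \<B>) :: ('v, 'k) mpoly set) m d' \<epsilon>"
    and h: "m (Suc 0) = 1" "d' (Suc 0) 0 = 0"
      "\<And>i k. k < m (Suc (Suc i)) \<Longrightarrow> d' (Suc (Suc i)) k = int (i + 1)"
    using M unfolding linear_res_def by blast
  let ?b = "Poly_Mapping.single (sqf B) 1 :: ('v, 'k) mpoly"
  have b: "?b \<in> carrier (poly_ring V)" "homogeneous (int c) ?b"
    using B homogeneous_single[of "sqf B" 1]
    by (simp_all add: single_closed keys_sqf mon_degree_sqf)
  obtain \<Delta> where D: "gres V (sqf_ideal V (insert B \<B>) :: ('v, 'k) mpoly set)
      (cone_rank n m) (cone_shift n d d' (int c)) \<Delta>"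
    by (rule gres_cone[OF sqf_ideal_hideal sqf_ideal_hideal b sqf_ideal_colon[OF B(1) _ B(2)]
          sqf_ideal_insert[OF B(1,2)] G H])
  have "cone_shift n d d' (int c) (Suc (Suc i)) k = int (i + c)"
    if k: "k < cone_rank n m (Suc (Suc i))" for i k
  proof (cases "k < n (Suc (Suc i))")
    case True
    then show ?thesis by (simp add: dsum_def g(4))
  next
    case False
    then have "k - n (Suc (Suc i)) < m (Suc i)" using k by simp
    \<comment> \<open>For \<open>i = 0\<close> this is the degree 0 of F_0 = R; for
      \<open>i = Suc l\<close> it is the linear degree \<open>l + 1\<close>. Shifted by
      \<open>c\<close> it agrees with the first complex.\<close>
    then have "d' (Suc i) (k - n (Suc (Suc i))) = int i"
      using h by (cases i) auto
    then show ?thesis using False by (simp add: dsum_def)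
  qed
  with D g h show ?thesis
    unfolding linear_res_def
    by (intro exI[of _ "cone_rank n m"] exI[of _ "cone_shift n d d' (int c)"] exI[of _ \<Delta>])
      (simp add: dsum_def)
qed

text \<open>In effect the Koszul complex: removing a new variable \<open>x\<close> from the other
  singletons changes nothing, so the colon ideal is the ideal itself and the induction hypothesis
  serves for both complexes of the cone.\<close>

lemma linear_res_variables:
  fixes V :: "'v set"
  assumes "finite X" "X \<subseteq> V"
  shows "linear_res V (sqf_ideal V ((\<lambda>x. {x}) ` X) :: ('v, 'k::field) mpoly set) 1 (card X)"
  using assms
proof (induction X rule: finite_induct)
  case empty
  then show ?case by (simp add: linear_res_zero)
next
  case (insert x X)
  have "(\<lambda>A. A - {x}) ` (\<lambda>x. {x}) ` X = (\<lambda>x. {x}) ` X"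
    using insert.hyps by (force simp: image_image)
  then show ?case
    using linear_res_insert[of "{x}" V 1 "(\<lambda>x. {x}) ` X" "card X" "card X", where 'k = 'k] insert by simp
qed

text \<open>
  The bases are added one at a time in the order of the binary numbers they represent under an
  enumeration of the vertices.  The exchange property makes each colon ideal an ideal of variables.
\<close>

lemma linear_res_matroid:
  fixes V :: "'v set"
  assumes V: "finite V" and bases: "\<And>A. A \<in> \<B> \<Longrightarrow> A \<subseteq> V \<and> card A = c"
    and exchange: "\<And>A B y. A \<in> \<B> \<Longrightarrow> B \<in> \<B> \<Longrightarrow> y \<in> B - A \<Longrightarrow> \<exists>x \<in> A - B. insert x (B - {y}) \<in> \<B>"
  shows "linear_res V (sqf_ideal V \<B> :: ('v, 'k::field) mpoly set) c (card \<B>)"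
proof -
  obtain idx :: "'v \<Rightarrow> nat" where idx: "inj_on idx V"
    using finite_imp_inj_to_nat_seg[OF V] by blast
  \<comment> \<open>Under this encoding two sets compare by the element of largest index in which
    they differ, and the induction can run over natural numbers.\<close>
  define key where "key = (\<lambda>A. \<Sum>x\<in>A. (2::nat) ^ idx x)"
  have fin: "finite A" if "A \<subseteq> V" for A
    using V that finite_subset by blast
  \<comment> \<open>The indices of \<open>A - B\<close> are distinct and below \<open>idx y\<close>,
    so their powers of two sum to less than \<open>2 ^ idx y\<close>.\<close>
  have key_less: "key A < key B"
    if "A \<subseteq> V" "B \<subseteq> V" "y \<in> B - A" "\<And>x. x \<in> A - B \<Longrightarrow> idx x < idx y" for A B y
  proof -
    have "key (A - B) = (\<Sum>i\<in>idx ` (A - B). 2 ^ i)"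
      unfolding key_def using inj_on_subset[OF idx, of "A - B"] that(1) by (subst sum.reindex) auto
    also have "\<dots> \<le> (\<Sum>i<idx y. 2 ^ i)"
      using that(4) by (intro sum_mono2) auto
    also have "\<dots> < 2 ^ idx y"
      by (simp add: sum_power2 flip: atLeast0LessThan)
    also have "\<dots> \<le> key (B - A)"
      unfolding key_def using that fin[of B] by (intro member_le_sum) auto
    finally have "key (A - B) < key (B - A)" .
    moreover have "key A = key (A \<inter> B) + key (A - B)" "key B = key (A \<inter> B) + key (B - A)"
      unfolding key_def using fin that
      by (auto simp: Int_commute sum.Int_Diff[of A _ B] sum.Int_Diff[of B _ A])
    ultimately show ?thesis by simp
  qed
  \<comment> \<open>Conversely, take \<open>y\<close> of largest index in the symmetric difference:
    if it lay in \<open>A - B\<close>, then \<open>key_less\<close> would give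
    \<open>key B < key A\<close>.\<close>
  have max_diff: "\<exists>y \<in> B - A. \<forall>x \<in> A - B. idx x < idx y"
    if AB: "A \<subseteq> V" "B \<subseteq> V" "A \<noteq> B" "key A \<le> key B" for A B
  proof -
    let ?D = "(A - B) \<union> (B - A)"
    have D: "finite (idx ` ?D)" "idx ` ?D \<noteq> {}" using fin AB by auto
    obtain y where y0: "y \<in> ?D" "Max (idx ` ?D) = idx y"
      using Max_in[OF D] by blast
    have y: "y \<in> ?D" "\<And>x. x \<in> ?D \<Longrightarrow> idx x \<le> idx y"
      using y0(1) Max_ge[OF D(1)] unfolding y0(2) by blast+
    have y': "idx x < idx y" if "x \<in> ?D" "x \<noteq> y" for x
    proof -
      have "x \<in> V" "y \<in> V" using that(1) y(1) AB by auto
      then have "idx x \<noteq> idx y" using that(2) idx by (auto dest: inj_onD)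
      then show ?thesis using y(2)[OF that(1)] by simp
    qed
    have "y \<notin> A - B"
    proof
      assume "y \<in> A - B"
      then have "key B < key A" using AB y' by (intro key_less[of B A y]) auto
      then show False using AB(4) by simp
    qed
    then have "y \<in> B - A" "\<forall>x \<in> A - B. idx x < idx y" using y(1) y' by auto
    then show ?thesis by blast
  qed
  \<comment> \<open>Distinct bases have distinct keys, so raising the threshold by one adds at most
    one basis.\<close>
  define Bt where "Bt = (\<lambda>t. {A \<in> \<B>. key A < t})"
  have finB: "finite (Bt t)" for t
    by (rule finite_subset[of _ "Pow V"]) (use V bases in \<open>auto simp: Bt_def\<close>)
  have lin: "linear_res V (sqf_ideal V (Bt t) :: ('v, 'k) mpoly set) c (card (Bt t))" for t
  proof (induction t)
    case 0
    then show ?case by (simp add: Bt_def linear_res_zero)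
  next
    case (Suc t)
    show ?case
    proof (cases "\<exists>B\<in>\<B>. key B = t")
      case False
      then have "Bt (Suc t) = Bt t" by (auto simp: Bt_def less_Suc_eq)
      then show ?thesis using Suc by simp
    next
      case True
      then obtain B where B: "B \<in> \<B>" "key B = t" by blast
      have "A = B" if A: "A \<in> \<B>" "key A = t" for A
      proof (rule ccontr)
        assume neq: "A \<noteq> B"
        have AV: "A \<subseteq> V" "B \<subseteq> V" "key A \<le> key B" using bases A B by simp_all
        obtain y where y: "y \<in> B - A" "\<forall>x \<in> A - B. idx x < idx y"
          using max_diff[OF AV(1,2) neq AV(3)] by blast
        have "key A < key B"
          by (rule key_less[OF AV(1,2) y(1)]) (use y in blast)
        then show False using A B by simp
      qed
      then have "A \<in> Bt (Suc t) \<longleftrightarrow> A \<in> insert B (Bt t)" for A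
        using B unfolding Bt_def less_Suc_eq by blast
      then have ins: "Bt (Suc t) = insert B (Bt t)"
        by blast
      \<comment> \<open>The variables that can replace some element of \<open>B\<close> to give an
        earlier basis; they will generate the colon ideal.\<close>
      define X where "X = {x \<in> V - B. \<exists>y\<in>B. insert x (B - {y}) \<in> Bt t}"
      have "(\<exists>A\<in>Bt t. A - B \<subseteq> U) \<longleftrightarrow> (\<exists>x\<in>X. {x} \<subseteq> U)" for U
      proof
        assume "\<exists>A\<in>Bt t. A - B \<subseteq> U"
        then obtain A where A: "A \<in> \<B>" "key A < key B" "A - B \<subseteq> U"
          using B by (auto simp: Bt_def)
        have AV: "A \<subseteq> V" "B \<subseteq> V" "A \<noteq> B" "key A \<le> key B" using bases A B by auto
        obtain y where y: "y \<in> B - A" "\<forall>x \<in> A - B. idx x < idx y"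
          using max_diff[OF AV] by blast
        \<comment> \<open>Removing the \<open>y\<close> of largest index is the point: whichever
          \<open>x\<close> the exchange supplies, it has smaller index, so the new basis comes
          before \<open>B\<close>, and \<open>x\<close> divides the generator coming from
          \<open>A\<close>.\<close>
        obtain x where x: "x \<in> A - B" "insert x (B - {y}) \<in> \<B>"
          using exchange[OF A(1) B(1) y(1)] by blast
        have xy: "x \<noteq> y" "idx x < idx y" using x(1) y by blast+
        have "key (insert x (B - {y})) < key B"
        proof (rule key_less[of _ _ y])
          show "insert x (B - {y}) \<subseteq> V" using AV(2) x(1) AV(1) by blast
          show "y \<in> B - insert x (B - {y})" using y(1) xy(1) by blast
          show "idx z < idx y" if "z \<in> insert x (B - {y}) - B" for z
            using that xy(2) by blast
        qed (rule AV(2))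
        then have "insert x (B - {y}) \<in> Bt t"
          using x(2) B(2) by (simp add: Bt_def)
        then have "x \<in> X"
          using x(1) y(1) AV(1) by (auto simp only: X_def)
        then show "\<exists>x\<in>X. {x} \<subseteq> U" using x(1) A(3) by blast
      next
        assume "\<exists>x\<in>X. {x} \<subseteq> U"
        then obtain x y where "x \<in> U" "x \<notin> B" "insert x (B - {y}) \<in> Bt t"
          by (auto simp: X_def)
        moreover have "insert x (B - {y}) - B \<subseteq> {x}" by blast
        ultimately show "\<exists>A\<in>Bt t. A - B \<subseteq> U" by blast
      qed
      then have "(sqf_ideal V ((\<lambda>A. A - B) ` Bt t) :: ('v, 'k) mpoly set) = sqf_ideal V ((\<lambda>x. {x}) ` X)"
        by (simp add: sqf_ideal_def)
      moreover have "finite X" "X \<subseteq> V"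
        using V by (auto simp: X_def)
      ultimately have "linear_res V (sqf_ideal V ((\<lambda>A. A - B) ` Bt t) :: ('v, 'k) mpoly set) 1 (card X)"
        using linear_res_variables[of X V, where 'k = 'k] by simp
      then have "linear_res V (sqf_ideal V (insert B (Bt t)) :: ('v, 'k) mpoly set) c (Suc (card (Bt t)))"
        using bases[OF B(1)] Suc fin by (intro linear_res_insert) auto
      moreover have "B \<notin> Bt t" using B by (simp add: Bt_def)
      ultimately show ?thesis by (simp add: ins finB)
    qed
  qed
  have fB: "finite \<B>"
    by (rule finite_subset[of _ "Pow V"]) (use V bases in auto)
  have "key A < Suc (\<Sum>A\<in>\<B>. key A)" if "A \<in> \<B>" for A
    using member_le_sum[OF that _ fB, of key] by simp
  then have "Bt (Suc (\<Sum>A\<in>\<B>. key A)) = \<B>"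
    unfolding Bt_def by blast
  then show ?thesis
    using lin[of "Suc (\<Sum>A\<in>\<B>. key A)"] by (simp only:)
qed


section \<open>Regularity\<close>

text \<open>A matrix entry between two basis vectors is homogeneous of the difference of their
  degrees; when this is nonzero the entry has no constant term.\<close>

lemma gminimal_of_shifts:
  fixes I :: "('v, 'k::field) mpoly set"
  assumes G: "gcomplex V I n d \<delta>"
    and less: "\<And>i k l. k < n (Suc (Suc i)) \<Longrightarrow> l < n (Suc i) \<Longrightarrow> d (Suc i) l \<noteq> d (Suc (Suc i)) k"
  shows "gminimal V n \<delta>"
  unfolding gminimal_def
proof (intro allI ballI)
  fix i and v :: "('v, 'k) pvec" assume v: "v \<in> fmod V (n (Suc (Suc i)))"
  have "Poly_Mapping.lookup (\<delta> (Suc i) (unitv k) l) 0 = 0" if k: "k < n (Suc (Suc i))" for k l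
  proof (cases "l < n (Suc i)")
    case True
    have "homogeneous (d (Suc (Suc i)) k - d (Suc i) l) (\<delta> (Suc i) (unitv k) l)"
      using ghomD(4)[OF gcomplexD(2)[OF G] unitv_gcomp[OF k]] by (simp add: gcomp_def)
    then have "0 \<notin> Poly_Mapping.keys (\<delta> (Suc i) (unitv k) l)"
      using less[OF k True] unfolding homogeneous_def by force
    then show ?thesis by (simp add: in_keys_iff)
  next
    case False
    then show ?thesis
      using ghomD(1)[OF gcomplexD(2)[OF G] unitv_fmod[OF k]] by (simp add: fmod_def)
  qed
  then show "\<delta> (Suc i) v \<in> mvec"
    by (simp add: ghom_expand[OF gcomplexD(2)[OF G] v] mvec_def sum_apply lookup_sum
        lookup_mult_0 mult.commute[of "v _"])
qed

text \<open>A single witness makes the choice in \<open>minimal_resolution\<close> a genuine minimal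
  resolution.\<close>

lemma minimal_resolution_of_gres:
  assumes V: "finite V" and I: "hideal V I" and G: "gres V I n d \<delta>" "gminimal V n \<delta>"
  shows "is_minimal_resolution V I (minimal_resolution V I)"
proof -
  obtain C where C: "is_graded_free_resolution V I C"
    "frank C = (\<lambda>i. n (Suc i))" "bdry C = (\<lambda>i. \<delta> (Suc i))"
    using resolution_of_gres[OF I G(1)] by metis
  have "bdry C i v k \<in> irrelevant_ideal V" if v: "v \<in> fmod V (frank C (Suc i))" for i v k
  proof -
    have v': "v \<in> fmod V (n (Suc (Suc i)))" using v by (simp add: C)
    have "\<delta> (Suc i) v \<in> fmod V (n (Suc i))"
      using G(1) ghomD(1)[OF gcomplexD(2)[of V I n d \<delta> "Suc i"] v'] by (simp add: gres_def)
    moreover have "\<delta> (Suc i) v \<in> mvec"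
      using G(2) v' unfolding gminimal_def by blast
    ultimately show ?thesis
      by (simp add: C irrelevant_ideal_eq[OF V] fmod_def mvec_def)
  qed
  then have "is_minimal_resolution V I C"
    using C(1) by (simp add: is_minimal_resolution_def carrier_free_module)
  then show ?thesis
    unfolding minimal_resolution_def by (rule someI)
qed

text \<open>The chosen resolution and the given one are both minimal, so
  \<open>gminimal_shifts_subset\<close> applies in both directions.\<close>

lemma betti_nonzero_iff:
  assumes V: "finite V" and I: "hideal V I" and G: "gres V I n d \<delta>" "gminimal V n \<delta>"
  shows "betti V I i j \<noteq> 0 \<longleftrightarrow> (\<exists>k < n (Suc i). d (Suc i) k = j)"
proof -
  define C where "C = minimal_resolution V I"
  have C: "is_graded_free_resolution V I C"
      "\<And>i v k. v \<in> fmod V (frank C (Suc i)) \<Longrightarrow> k < frank C i \<Longrightarrow> bdry C i v k \<in> irrelevant_ideal V"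
    using minimal_resolution_of_gres[OF assms]
    by (auto simp: C_def is_minimal_resolution_def carrier_free_module)
  obtain a where H: "gres V I (case_nat 1 (frank C)) (case_nat (\<lambda>_. 0) (shift C)) (case_nat a (bdry C))"
    using gres_of_resolution[OF I C(1)] .
  have "bdry C i v \<in> mvec" if v: "v \<in> fmod V (frank C (Suc i))" for i v
    unfolding mvec_def
  proof (intro CollectI allI)
    fix k
    have "ghom V (frank C (Suc i)) (shift C (Suc i)) (frank C i) (shift C i) (bdry C i)"
      using H gcomplexD(2)[of V I "case_nat 1 (frank C)" "case_nat (\<lambda>_. 0) (shift C)" "case_nat a (bdry C)" "Suc i"]
      by (simp add: gres_def)
    then have "bdry C i v \<in> fmod V (frank C i)"
      using v by (rule ghomD(1))
    then show "Poly_Mapping.lookup (bdry C i v k) 0 = 0"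
      using C(2)[OF v, of k] by (cases "k < frank C i") (simp_all add: fmod_def irrelevant_ideal_eq[OF V])
  qed
  then have "gminimal V (case_nat 1 (frank C)) (case_nat a (bdry C))"
    by (simp add: gminimal_def)
  note sub = gminimal_shifts_subset[OF I H this G(1), of _ i] gminimal_shifts_subset[OF I G H, of _ i]
  have "betti V I i j \<noteq> 0 \<longleftrightarrow> (\<exists>k < frank C i. shift C i k = j)"
    by (auto simp: betti_def Let_def C_def)
  also have "\<dots> \<longleftrightarrow> (\<exists>k < n (Suc i). d (Suc i) k = j)"
    using sub by fastforce
  finally show ?thesis .
qed

text \<open>F_0 = R contributes 0, and F_i with i > 0 contributes (i - 1) + (r + 1) - i = r;
  \<open>N > 0\<close> makes the second value occur. The degrees 0, r + 1, r + 2, and so on increase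
  strictly along the resolution, which gives minimality.\<close>

lemma regularity_linear_res:
  assumes V: "finite V" and I: "hideal V I" and L: "linear_res V I (Suc r) N" and N: "N > 0"
  shows "regularity V I = int r"
proof -
  obtain n d \<delta> where G: "gres V I n d \<delta>"
    and n: "n (Suc 0) = 1" "d (Suc 0) 0 = 0" "n (Suc (Suc 0)) = N"
      "\<And>i k. k < n (Suc (Suc i)) \<Longrightarrow> d (Suc (Suc i)) k = int (i + Suc r)"
    using L unfolding linear_res_def by blast
  have m: "gminimal V n \<delta>"
  proof (rule gminimal_of_shifts)
    show "gcomplex V I n d \<delta>" using G by (simp add: gres_def)
    show "d (Suc i) l \<noteq> d (Suc (Suc i)) k" if "k < n (Suc (Suc i))" "l < n (Suc i)" for i k l
    proof (cases i)
      case 0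
      then have "l = 0" using that(2) n(1) by simp
      then show ?thesis using 0 n(2) n(4)[OF that(1)] by simp
    next
      case (Suc j)
      then have "d (Suc i) l = int (j + Suc r)" using n(4)[of l j] that(2) by simp
      then show ?thesis using n(4)[OF that(1)] Suc by simp
    qed
  qed
  have b: "betti V I i j \<noteq> 0 \<longleftrightarrow> (\<exists>k < n (Suc i). d (Suc i) k = j)" for i j
    by (rule betti_nonzero_iff[OF V I G m])
  have "{j - int i | i j. betti V I i j \<noteq> 0} = {0, int r}"
  proof
    show "{j - int i | i j. betti V I i j \<noteq> 0} \<subseteq> {0, int r}"
    proof
      fix x assume "x \<in> {j - int i | i j. betti V I i j \<noteq> 0}"
      then obtain i k where k: "k < n (Suc i)" "x = d (Suc i) k - int i"
        unfolding b by blast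
      show "x \<in> {0, int r}"
      proof (cases i)
        case 0
        then show ?thesis using k n(1,2) by simp
      next
        case (Suc j)
        then show ?thesis using k n(4)[of k j] by simp
      qed
    qed
    have "betti V I 0 0 \<noteq> 0" unfolding b using n by auto
    moreover have "betti V I 1 (int (Suc r)) \<noteq> 0"
      unfolding b using n(3) n(4)[of 0 0] N by auto
    ultimately show "{0, int r} \<subseteq> {j - int i | i j. betti V I i j \<noteq> 0}"
      by (auto intro: exI[of _ "0::nat"]) force
  qed
  then show ?thesis by (simp add: regularity_def)
qed


section \<open>Complete multipartite graphs\<close>

text \<open>Vertices of the same part are joined through a vertex of another part; if there is none,
  the induced graph has no arcs and reachability is equality. The bound on \<open>card A\<close>
  excludes singletons, which are connected inside one part.\<close>

lemma connected_complete_multipartite_iff: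
  assumes A: "A \<subseteq> pverts (complete_multipartite ns)" "card A \<ge> 2"
  shows "Digraph_Component.connected (with_proj (complete_multipartite ns) \<restriction> A)
    \<longleftrightarrow> (\<exists>u\<in>A. \<exists>v\<in>A. fst u \<noteq> fst v)"
proof -
  define H where "H = mk_symmetric (with_proj (complete_multipartite ns) \<restriction> A)"
  have arcs: "arcs (with_proj (complete_multipartite ns) \<restriction> A) = {(u, v). u \<in> A \<and> v \<in> A \<and> fst u \<noteq> fst v}"
    using A(1) by (auto simp: complete_multipartite_def Let_def induce_subgraph_def)
  have H1: "pverts H = A"
    by (simp add: H_def induce_subgraph_def)
  have "parcs H = (\<Union>e \<in> {(u, v). u \<in> A \<and> v \<in> A \<and> fst u \<noteq> fst v}. {(fst e, snd e), (snd e, fst e)})"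
    unfolding H_def parcs_mk_symmetric arcs by (simp add: induce_subgraph_def)
  also have "\<dots> = {(u, v). u \<in> A \<and> v \<in> A \<and> fst u \<noteq> fst v}"
  proof -
    have "\<And>u v. u \<in> A \<Longrightarrow> v \<in> A \<Longrightarrow> fst u \<noteq> fst v \<Longrightarrow>
        (u, v) \<in> (\<Union>e \<in> {(u, v). u \<in> A \<and> v \<in> A \<and> fst u \<noteq> fst v}. {(fst e, snd e), (snd e, fst e)})"
      by (rule UN_I[of "(_, _)"]) auto
    then show ?thesis by auto
  qed
  finally have H: "pverts H = A" "parcs H = {(u, v). u \<in> A \<and> v \<in> A \<and> fst u \<noteq> fst v}"
    using H1 by auto
  have reach: "u \<rightarrow>\<^sup>*\<^bsub>H\<^esub> v \<longleftrightarrow> (u, v) \<in> rtrancl_on A (parcs H)" for u v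
    by (simp add: reachable_def H(1) arcs_ends_conv)
  have "A \<noteq> {}" using A(2) by auto
  then have conn: "Digraph_Component.connected (with_proj (complete_multipartite ns) \<restriction> A)
    \<longleftrightarrow> (\<forall>u\<in>A. \<forall>v\<in>A. (u, v) \<in> rtrancl_on A (parcs H))"
    unfolding Digraph_Component.connected_def strongly_connected_def H_def[symmetric]
    by (simp add: H(1) reach)
  show ?thesis
    unfolding conn
  proof
    assume c: "\<forall>u\<in>A. \<forall>v\<in>A. (u, v) \<in> rtrancl_on A (parcs H)"
    show "\<exists>u\<in>A. \<exists>v\<in>A. fst u \<noteq> fst v"
    proof (rule ccontr)
      assume "\<not> ?thesis"
      then have "parcs H = {}" unfolding H(2) by blast
      then have eq: "u = v" if "u \<in> A" "v \<in> A" for u v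
        using c that by (auto elim: rtrancl_on.cases)
      have "card A \<le> 1"
        using eq card_le_Suc0_iff_eq[of A] A(2) by (cases "finite A") auto
      then show False using A(2) by simp
    qed
  next
    assume "\<exists>u\<in>A. \<exists>v\<in>A. fst u \<noteq> fst v"
    then obtain a b where ab: "a \<in> A" "b \<in> A" "fst a \<noteq> fst b" by blast
    have step: "(u, v) \<in> rtrancl_on A (parcs H)" if "u \<in> A" "v \<in> A" "fst u \<noteq> fst v" for u v
      using that H(2) by (intro rtrancl_on_into_rtrancl_on[OF rtrancl_on_refl]) auto
    show "\<forall>u\<in>A. \<forall>v\<in>A. (u, v) \<in> rtrancl_on A (parcs H)"
    proof (intro ballI)
      fix u v assume uv: "u \<in> A" "v \<in> A"
      obtain w where w: "w \<in> A" "fst w \<noteq> fst u"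
        using ab by (cases "fst a = fst u") auto
      show "(u, v) \<in> rtrancl_on A (parcs H)"
      proof (cases "fst u = fst v")
        case True
        then show ?thesis
          using step[OF uv(1) w(1)] step[OF w(1) uv(2)] w(2) by (auto intro: rtrancl_on_trans)
      qed (rule step[OF uv])
    qed
  qed
qed

theorem corollary4p5:
  fixes ns :: "nat list" and r :: nat
  assumes "length ns \<ge> 2" and "\<forall>n \<in> set ns. n > 0"
    and "r > 0" and "r < sum_list ns"
  shows "regularity (pverts (complete_multipartite ns))
           (connected_ideal r (complete_multipartite ns) :: (nat \<times> nat, 'k::field) mpoly set)
         = int r"
proof -
  define V where "V = pverts (complete_multipartite ns)"
  interpret pair_graph "complete_multipartite ns" by (rule complete_multipartite_pair_graph)
  have V: "finite V" "card V = sum_list ns"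
    by (simp_all add: V_def card_complete_multipartite)
  define \<B> where "\<B> = {A. A \<subseteq> V \<and> card A = Suc r \<and> (\<exists>u\<in>A. \<exists>v\<in>A. fst u \<noteq> fst v)}"
  have fin: "finite A" if "A \<in> \<B>" for A
    using that V(1) finite_subset unfolding \<B>_def by blast
  have "{\<Prod>x\<in>A. var x | A. A \<subseteq> V \<and> card A = r + 1
        \<and> Digraph_Component.connected (with_proj (complete_multipartite ns) \<restriction> A)}
      = ((\<lambda>A. Poly_Mapping.single (sqf A) 1) ` \<B> :: (nat \<times> nat, 'k) mpoly set)"
  proof -
    have "A \<subseteq> V \<and> card A = r + 1 \<and> Digraph_Component.connected (with_proj (complete_multipartite ns) \<restriction> A)
        \<longleftrightarrow> A \<in> \<B>" for A
    proof (cases "A \<subseteq> V \<and> card A = r + 1")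
      case True
      then show ?thesis
        using connected_complete_multipartite_iff[of A ns] \<open>r > 0\<close> by (simp add: \<B>_def V_def)
    qed (auto simp: \<B>_def)
    then have "{\<Prod>x\<in>A. var x | A. A \<subseteq> V \<and> card A = r + 1
          \<and> Digraph_Component.connected (with_proj (complete_multipartite ns) \<restriction> A)}
        = ((\<lambda>A. \<Prod>x\<in>A. var x) ` \<B> :: (nat \<times> nat, 'k) mpoly set)"
      by (simp only: image_def) blast
    also have "\<dots> = (\<lambda>A. Poly_Mapping.single (sqf A) 1) ` \<B>"
      by (intro image_cong refl prod_var fin)
    finally show ?thesis .
  qed
  then have I: "(connected_ideal r (complete_multipartite ns) :: (nat \<times> nat, 'k) mpoly set) = sqf_ideal V \<B>"
    unfolding connected_ideal_def V_def[symmetric]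
    using sqf_ideal_eq_genideal[OF V(1), of \<B>, where 'k = 'k] by (simp add: \<B>_def)
  have "linear_res V (sqf_ideal V \<B> :: (nat \<times> nat, 'k) mpoly set) (Suc r) (card \<B>)"
  proof (rule linear_res_matroid[OF V(1)])
    show "A \<subseteq> V \<and> card A = Suc r" if "A \<in> \<B>" for A
      using that by (simp add: \<B>_def)
    fix A B y assume A: "A \<in> \<B>" and B: "B \<in> \<B>" and y: "y \<in> B - A"
    have cB: "card (B - {y}) = r"
      using B y fin[OF B] by (simp add: \<B>_def)
    \<comment> \<open>\<open>r > 0\<close> leaves a vertex \<open>z\<close> in
      \<open>B - {y}\<close>. If every exchange fails, the part of \<open>z\<close> will be shown to
      contain all of \<open>A\<close>.\<close>
    then obtain z where z: "z \<in> B - {y}"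
      using \<open>r > 0\<close> by (metis card.empty ex_in_conv less_irrefl)
    show "\<exists>x \<in> A - B. insert x (B - {y}) \<in> \<B>"
    proof (rule ccontr)
      assume neg: "\<not> ?thesis"
      have same: "fst u = fst z" if x: "x \<in> A - B" and u: "u \<in> insert x (B - {y})" for x u
      proof (rule ccontr)
        assume "fst u \<noteq> fst z"
        moreover have "insert x (B - {y}) \<subseteq> V" "card (insert x (B - {y})) = Suc r"
          using A B x cB fin[OF B] by (auto simp: \<B>_def)
        ultimately have "insert x (B - {y}) \<in> \<B>"
          using u z unfolding \<B>_def by blast
        then show False using neg x by blast
      qed
      have "A - B \<noteq> {}"
      proof
        assume "A - B = {}"
        then have "A = B"
          using A B fin[OF B] by (intro card_subset_eq) (auto simp: \<B>_def)
        then show False using y by simp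
      qed
      \<comment> \<open>As \<open>y\<close> is not in \<open>A\<close>, each \<open>u\<close> lies
        in \<open>A - B\<close> or in \<open>B - {y}\<close>; in the second case some element of
        \<open>A - B\<close> is still required to form a failed exchange containing
        \<open>u\<close>.\<close>
      then have "fst u = fst z" if "u \<in> A" for u
        using same that y by (cases "u \<in> B") blast+
      then show False using A by (auto simp: \<B>_def)
    qed
  qed
  moreover have "\<B> \<noteq> {}"
  proof -
    \<comment> \<open>One vertex from each of the first two parts is extended to a set of
      \<open>r + 1\<close> vertices; this is possible because 2 \<le> r + 1 \<le>
      \<open>card V\<close>.\<close>
    have "0 < length ns" "1 < length ns" using assms(1) by auto
    then have "ns ! 0 > 0" "ns ! 1 > 0" using assms(2) nth_mem by blast+
    then have ab: "{(0, 0), (1, 0)} \<subseteq> V"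
      using assms(1) by (auto simp: V_def complete_multipartite_def Let_def)
    have "card {(0::nat, 0::nat), (1, 0)} = 2" by simp
    then have "\<exists>A. {(0, 0), (1, 0)} \<subseteq> A \<and> A \<subseteq> V \<and> card A = Suc r"
      using ab V assms(3,4) by (intro exists_subset_between) simp_all
    then obtain A where "{(0, 0), (1, 0)} \<subseteq> A" "A \<subseteq> V" "card A = Suc r" by blast
    then have "(0, 0) \<in> A" "(1, 0) \<in> A" by auto
    then have "\<exists>u\<in>A. \<exists>v\<in>A. fst u \<noteq> fst v"
      by (intro bexI[of _ "(0, 0)"] bexI[of _ "(1, 0)"]) auto
    then have "A \<in> \<B>"
      using \<open>A \<subseteq> V\<close> \<open>card A = Suc r\<close> by (simp add: \<B>_def)
    then show ?thesis by blast
  qed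
  moreover have "finite \<B>"
    by (rule finite_subset[of _ "Pow V"]) (use V(1) in \<open>auto simp: \<B>_def\<close>)
  ultimately show ?thesis
    unfolding I V_def[symmetric]
    by (intro regularity_linear_res[OF V(1) sqf_ideal_hideal, of _ _ "card \<B>"])
      (simp_all only: card_gt_0_iff simp_thms)
qed

end
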